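(* Let $\mathcal{H}_n$ be the Connes-Moscovici Hopf algebra and let $A$ be a finite dimensional right comodule algebra over $\mathcal{H}_n$ with non-trivial coaction. Then there is no total integral $f\colon \mathcal{H}_n\to A$ which is an algebra map.
   Context: A coaction is trivial if it is $a\mapsto a\otimes 1$. For a Hopf algebra $H$ and a right $H$-comodule algebra $A$ with coaction $a\mapsto a_{\langle 0\rangle}\otimes a_{\langle 1\rangle}$, a total integral is a linear map $f\colon H\to A$ with $f(1)=1$ and $f(h^{(1)})\otimes h^{(2)}=f(h)_{\langle 0\rangle}\otimes f(h)_{\langle 1\rangle}$. The Connes-Moscovici Hopf algebra $\mathcal{H}_n$ (over $\mathbb{C}$) is the standard one: on the frame bundle $F\mathbb{R}^n$ with coordinates $(x^\mu,y^\mu_j)$, $y\in GL_n(\mathbb{R})$, put $X_k=y^\mu_k\partial/\partial x^\mu$, $Y_i^j=y_i^\mu\partial/\partial y_j^\mu$. On the crossed product $C_c^\infty(F\mathbb{R}^n)\rtimes \mathrm{Diff}(\mathbb{R}^n)$, spanned by elements $gU_\phi^*$, let $X_k(gU_\phi^* )=X_k(g)U_\phi^*$, $Y_i^j(gU_\phi^* )=Y_i^j(g)U_\phi^*$ and $\delta^i_{jk}(gU_\phi^* )=\gamma^i_{jk}(\phi)gU_\phi^*$ with $\gamma^i_{jk}(\phi)(x,y)=(y^{-1}\phi'(x)^{-1}\partial_\mu\phi'(x)\,y)^i_j\,y^\mu_k$. $\mathcal{H}_n$ is the algebra of linear operators generated by all $X_k,Y_i^j,\delta^i_{jk}$, with coproduct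 determined by $h(ab)=h^{(1)}(a)h^{(2)}(b)$ and counit by $h(1)=\varepsilon(h)1$. *)

theory Defs
  imports "HOL-Analysis.Analysis" "HOL-Library.Poly_Mapping"
begin

section \<open>Smooth maps\<close>

text \<open>For open \<open>S\<close> and finite-dimensional domains, \<open>Ck_on k S\<close> is the usual class \<open>C\<^sup>k\<close>:
  all iterated directional derivatives up to order \<open>k\<close> exist and are continuous.\<close>

primrec Ck_on :: "nat \<Rightarrow> 'a::real_normed_vector set \<Rightarrow> ('a \<Rightarrow> 'b::real_normed_vector) \<Rightarrow> bool" where
  "Ck_on 0 S f \<longleftrightarrow> continuous_on S f"
| "Ck_on (Suc k) S f \<longleftrightarrow> (\<forall>x\<in>S. f differentiable (at x)) \<and>
     (\<forall>v. Ck_on k S (\<lambda>x. frechet_derivative f (at x) v))"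

definition smooth_on :: "'a::real_normed_vector set \<Rightarrow> ('a \<Rightarrow> 'b::real_normed_vector) \<Rightarrow> bool" where
  "smooth_on S f \<longleftrightarrow> (\<forall>k. Ck_on k S f)"

lemma frechet_derivativeI: "(f has_derivative f') (at x) \<Longrightarrow> frechet_derivative f (at x) = f'"
  using frechet_derivative_at by metis

lemma Ck_on_cong:
  assumes "open S" "\<And>x. x \<in> S \<Longrightarrow> f x = g x" "Ck_on k S f"
  shows "Ck_on k S g"
  using assms(2,3)
proof (induction k arbitrary: f g)
  case 0
  then show ?case by (metis Ck_on.simps(1) continuous_on_cong)
next
  case (Suc k)
  have d: "(g has_derivative frechet_derivative f (at x)) (at x)" if "x \<in> S" for x
  proof (rule has_derivative_transform_within_open[OF _ \<open>open S\<close> that])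
    show "(f has_derivative frechet_derivative f (at x)) (at x)"
      using Suc.prems(2) that by (simp add: frechet_derivative_works[THEN iffD1])
  qed (rule Suc.prems(1))
  have "frechet_derivative f (at x) v = frechet_derivative g (at x) v" if "x \<in> S" for x v
    using frechet_derivativeI[OF d[OF that]] by simp
  moreover have "Ck_on k S (\<lambda>x. frechet_derivative f (at x) v)" for v
    using Suc.prems(2) by simp
  ultimately have "Ck_on k S (\<lambda>x. frechet_derivative g (at x) v)" for v
    by (rule Suc.IH)
  moreover have "g differentiable (at x)" if "x \<in> S" for x
    using d[OF that] by (rule differentiableI)
  ultimately show ?case by simp
qed

lemma Ck_on_SucI:
  assumes "open S" "\<And>x. x \<in> S \<Longrightarrow> (f has_derivative f' x) (at x)"
    "\<And>v. Ck_on k S (\<lambda>x. f' x v)"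
  shows "Ck_on (Suc k) S f"
proof -
  have "Ck_on k S (\<lambda>x. frechet_derivative f (at x) v)" for v
    by (rule Ck_on_cong[OF \<open>open S\<close> _ assms(3)]) (simp add: frechet_derivativeI[OF assms(2)])
  then show ?thesis using assms(2) by (auto intro: differentiableI)
qed

lemma Ck_on_SucD: "Ck_on (Suc k) S f \<Longrightarrow> Ck_on k S f"
proof (induction k arbitrary: f)
  case 0
  then show ?case
    by (simp add: continuous_at_imp_continuous_on differentiable_imp_continuous_within)
next
  case (Suc k)
  have "\<forall>x\<in>S. f differentiable (at x)" "Ck_on (Suc k) S (\<lambda>x. frechet_derivative f (at x) v)" for v
    using Suc.prems unfolding Ck_on.simps(2)[of "Suc k"] by blast+
  with Suc.IH show ?case unfolding Ck_on.simps(2)[of k] by blast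
qed

lemma Ck_on_has_derivative:
  "Ck_on (Suc k) S f \<Longrightarrow> x \<in> S \<Longrightarrow> (f has_derivative frechet_derivative f (at x)) (at x)"
  by (simp add: frechet_derivative_works[THEN iffD1])

lemma Ck_on_const: "open S \<Longrightarrow> Ck_on k S (\<lambda>x. c)"
proof (induction k arbitrary: c)
  case (Suc k)
  then show ?case by (intro Ck_on_SucI[where f' = "\<lambda>x v. 0"]) auto
qed simp

lemma Ck_on_linear:
  assumes "open S" "bounded_linear f" shows "Ck_on k S f"
proof (cases k)
  case 0
  then show ?thesis using assms by (simp add: linear_continuous_on)
next
  case (Suc m)
  show ?thesis unfolding Suc
    by (rule Ck_on_SucI[where f' = "\<lambda>x. f", OF assms(1)])
      (rule bounded_linear_imp_has_derivative[OF assms(2)], rule Ck_on_const[OF assms(1)])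
qed

lemma Ck_on_add:
  assumes "open S" "Ck_on k S f" "Ck_on k S g"
  shows "Ck_on k S (\<lambda>x. f x + g x)"
  using assms(2,3)
proof (induction k arbitrary: f g)
  case 0
  then show ?case by (simp add: continuous_on_add)
next
  case (Suc k)
  show ?case
    using Suc Ck_on_has_derivative[OF Suc.prems(1)] Ck_on_has_derivative[OF Suc.prems(2)]
    by (intro Ck_on_SucI[OF \<open>open S\<close>, where f' =
        "\<lambda>x v. frechet_derivative f (at x) v + frechet_derivative g (at x) v"])
      (auto intro!: has_derivative_add)
qed

lemma Ck_on_bilinear:
  assumes "open S" "bounded_bilinear p" "Ck_on k S f" "Ck_on k S g"
  shows "Ck_on k S (\<lambda>x. p (f x) (g x))"
  using assms(3,4)
proof (induction k arbitrary: f g)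
  case 0
  then show ?case using bounded_bilinear.continuous_on[OF assms(2)] by simp
next
  case (Suc k)
  interpret bounded_bilinear p by fact
  show ?case
  proof (rule Ck_on_SucI[OF \<open>open S\<close>])
    fix x assume "x \<in> S"
    then show "((\<lambda>x. p (f x) (g x)) has_derivative
      (\<lambda>v. p (f x) (frechet_derivative g (at x) v) + p (frechet_derivative f (at x) v) (g x))) (at x)"
      using Suc.prems by (intro FDERIV) (auto intro: Ck_on_has_derivative)
  next
    fix v
    show "Ck_on k S (\<lambda>x. p (f x) (frechet_derivative g (at x) v) + p (frechet_derivative f (at x) v) (g x))"
      using Ck_on_SucD[OF Suc.prems(1)] Ck_on_SucD[OF Suc.prems(2)] Suc.prems
      by (intro Ck_on_add assms(1) Suc.IH) simp_all
  qed
qed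

lemma Ck_on_linear_compose:
  assumes "open S" "bounded_linear h" "Ck_on k S f"
  shows "Ck_on k S (\<lambda>x. h (f x))"
  using assms(3)
proof (induction k arbitrary: f)
  case 0
  then show ?case using bounded_linear.continuous_on[OF assms(2)] by simp
next
  case (Suc k)
  show ?case using Suc Ck_on_has_derivative[OF Suc.prems]
    by (intro Ck_on_SucI[OF \<open>open S\<close>, where f' = "\<lambda>x v. h (frechet_derivative f (at x) v)"])
      (auto intro!: bounded_linear.has_derivative[OF assms(2)])
qed

lemma Ck_on_sum:
  assumes "open S" "\<And>i. i \<in> I \<Longrightarrow> Ck_on k S (f i)"
  shows "Ck_on k S (\<lambda>x. \<Sum>i\<in>I. f i x)"
  using assms(2)
  by (induction I rule: infinite_finite_induct) (auto intro: Ck_on_const Ck_on_add assms(1))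

lemma Ck_on_prod:
  fixes f :: "'i \<Rightarrow> 'a::real_normed_vector \<Rightarrow> real"
  assumes "open S" "\<And>i. i \<in> I \<Longrightarrow> Ck_on k S (f i)"
  shows "Ck_on k S (\<lambda>x. \<Prod>i\<in>I. f i x)"
  using assms(2)
  by (induction I rule: infinite_finite_induct)
    (auto intro: Ck_on_const Ck_on_bilinear[OF _ bounded_bilinear_mult] assms(1))

lemma Ck_on_inverse:
  fixes f :: "'a::real_normed_vector \<Rightarrow> real"
  assumes "open S" "Ck_on k S f" "\<And>x. x \<in> S \<Longrightarrow> f x \<noteq> 0"
  shows "Ck_on k S (\<lambda>x. inverse (f x))"
  using assms(2)
proof (induction k)
  case 0
  then show ?case using assms(3) by (auto intro: continuous_on_inverse)
next
  case (Suc k)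
  have i: "Ck_on k S (\<lambda>x. inverse (f x))" using Suc Ck_on_SucD by blast
  show ?case
  proof (rule Ck_on_SucI[OF \<open>open S\<close>])
    fix x assume "x \<in> S"
    then show "((\<lambda>x. inverse (f x)) has_derivative
       (\<lambda>v. - (inverse (f x) * frechet_derivative f (at x) v * inverse (f x)))) (at x)"
      using assms(3) Ck_on_has_derivative[OF Suc.prems] by (intro Deriv.has_derivative_inverse) auto
  next
    fix v
    have "Ck_on k S (\<lambda>x. frechet_derivative f (at x) v)" using Suc.prems by auto
    then show "Ck_on k S (\<lambda>x. - (inverse (f x) * frechet_derivative f (at x) v * inverse (f x)))"
      using i by (intro Ck_on_linear_compose[OF _ bounded_linear_minus[OF bounded_linear_ident]]
          Ck_on_bilinear[OF _ bounded_bilinear_mult] assms(1))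
  qed
qed

lemma Ck_on_compose:
  fixes f :: "'a::real_normed_vector \<Rightarrow> 'b::euclidean_space"
    and g :: "'b \<Rightarrow> 'c::real_normed_vector"
  assumes "open S" "Ck_on k S f" "Ck_on k T g" "f ` S \<subseteq> T"
  shows "Ck_on k S (\<lambda>x. g (f x))"
  using assms(2,3)
proof (induction k arbitrary: g)
  case 0
  then show ?case using assms(4) by (auto intro: continuous_on_compose2)
next
  case (Suc k)
  show ?case
  proof (rule Ck_on_SucI[OF \<open>open S\<close>])
    fix x assume x: "x \<in> S"
    have g': "(g has_derivative frechet_derivative g (at (f x))) (at (f x))"
      using Suc.prems assms(4) x by (intro Ck_on_has_derivative[of k T]) auto
    interpret G: bounded_linear "frechet_derivative g (at (f x))"
      using g' has_derivative_bounded_linear by blast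
    have A: "((\<lambda>x. g (f x)) has_derivative
        (\<lambda>v. frechet_derivative g (at (f x)) (frechet_derivative f (at x) v))) (at x)"
      using has_derivative_compose[OF Ck_on_has_derivative[OF Suc.prems(1) x] g'] .
    have B: "frechet_derivative g (at (f x)) w =
        (\<Sum>b\<in>Basis. (w \<bullet> b) *\<^sub>R frechet_derivative g (at (f x)) b)" for w
      by (subst euclidean_representation[of w, symmetric]) (simp only: G.sum G.scaleR)
    show "((\<lambda>x. g (f x)) has_derivative (\<lambda>v. \<Sum>b\<in>Basis. (frechet_derivative f (at x) v \<bullet> b)
         *\<^sub>R frechet_derivative g (at (f x)) b)) (at x)"
      by (rule has_derivative_eq_rhs[OF A]) (rule ext, rule B)
  next
    fix v
    have 1: "Ck_on k S (\<lambda>x. frechet_derivative g (at (f x)) b)" for b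
      using Ck_on_SucD[OF Suc.prems(1)] Suc.prems by (intro Suc.IH) simp_all
    have 2: "Ck_on k S (\<lambda>x. frechet_derivative f (at x) v)"
      using Suc.prems by auto
    show "Ck_on k S (\<lambda>x. \<Sum>b\<in>Basis. (frechet_derivative f (at x) v \<bullet> b)
         *\<^sub>R frechet_derivative g (at (f x)) b)"
      by (intro Ck_on_sum Ck_on_bilinear[OF _ bounded_bilinear_scaleR] 1 assms(1)
          Ck_on_linear_compose[OF _ bounded_linear_inner_left 2])
  qed
qed

lemma Ck_on_vec:
  fixes f :: "'a::real_normed_vector \<Rightarrow> 'i::finite \<Rightarrow> 'b::euclidean_space"
  assumes "open S" "\<And>i. Ck_on k S (\<lambda>x. f x i)"
  shows "Ck_on k S (\<lambda>x. \<chi> i. f x i)"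
proof -
  have "Ck_on k S (\<lambda>x. \<Sum>i\<in>UNIV. axis i (f x i))"
  proof (intro Ck_on_sum assms(1))
    fix i
    have "linear (axis i :: 'b \<Rightarrow> 'b^'i)"
      by (auto simp: linear_iff axis_def vec_eq_iff)
    then have "bounded_linear (axis i :: 'b \<Rightarrow> 'b^'i)"
      by (rule linear_conv_bounded_linear[THEN iffD1])
    then show "Ck_on k S (\<lambda>x. axis i (f x i))"
      using Ck_on_linear_compose[OF assms(1) _ assms(2)] by auto
  qed
  moreover have "(\<Sum>i\<in>UNIV. axis i (f x i)) = (\<chi> i. f x i)" for x
    by (auto simp: vec_eq_iff axis_def)
  ultimately show ?thesis by simp
qed

lemma Ck_on_Pair:
  assumes "open S" "Ck_on k S f" "Ck_on k S g"
  shows "Ck_on k S (\<lambda>x. (f x, g x))"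
  using assms(2,3)
proof (induction k arbitrary: f g)
  case 0
  then show ?case by (simp add: continuous_on_Pair)
next
  case (Suc k)
  show ?case
    using Suc Ck_on_has_derivative[OF Suc.prems(1)] Ck_on_has_derivative[OF Suc.prems(2)]
    by (intro Ck_on_SucI[OF \<open>open S\<close>, where f' =
        "\<lambda>x v. (frechet_derivative f (at x) v, frechet_derivative g (at x) v)"])
      (auto intro!: has_derivative_Pair)
qed

lemma Ck_on_nth:
  assumes "open S" "Ck_on k S f" shows "Ck_on k S (\<lambda>x. f x $ i)"
  by (rule Ck_on_linear_compose[OF assms(1) bounded_linear_vec_nth assms(2)])

lemma Ck_on_matrix_mult:
  fixes A :: "'a::real_normed_vector \<Rightarrow> real^'m^'l" and B :: "'a \<Rightarrow> real^'k^'m"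
  assumes "open S" "Ck_on k S A" "Ck_on k S B"
  shows "Ck_on k S (\<lambda>x. A x ** B x)"
  unfolding matrix_matrix_mult_def
  by (intro Ck_on_vec Ck_on_sum Ck_on_bilinear[OF _ bounded_bilinear_mult] Ck_on_nth assms)

lemma Ck_on_det:
  fixes A :: "'a::real_normed_vector \<Rightarrow> real^'m^'m"
  assumes "open S" "Ck_on k S A"
  shows "Ck_on k S (\<lambda>x. det (A x))"
  unfolding det_def
  by (intro Ck_on_sum Ck_on_prod Ck_on_bilinear[OF _ bounded_bilinear_mult] Ck_on_const Ck_on_nth assms)

lemma matrix_inv_props:
  fixes A :: "real^'m^'m"
  assumes "invertible A"
  shows "A ** matrix_inv A = mat 1" "matrix_inv A ** A = mat 1"
  using someI_ex[OF assms[unfolded invertible_def]] by (simp_all add: matrix_inv_def)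

lemma matrix_inv_cramer:
  fixes A :: "real^'m^'m"
  assumes "invertible A"
  shows "matrix_inv A = (\<chi> i j. det (\<chi> a b. if b = i then axis j 1 $ a else A $ a $ b) / det A)"
proof -
  have d: "det A \<noteq> 0" using assms by (simp add: invertible_det_nz)
  have "matrix_inv A $ i $ j = det (\<chi> a b. if b = i then axis j 1 $ a else A $ a $ b) / det A" for i j
  proof -
    have "A *v (matrix_inv A *v axis j 1) = axis j 1"
      using matrix_inv_props(1)[OF assms] by (simp add: matrix_vector_mul_assoc)
    then have "matrix_inv A *v axis j 1 =
        (\<chi> k. det (\<chi> a b. if b = k then axis j 1 $ a else A $ a $ b) / det A)"
      using cramer[OF d] by blast
    moreover have "(matrix_inv A *v axis j 1) $ i = matrix_inv A $ i $ j"
      by (simp add: matrix_vector_mult_def axis_def if_distrib[of "(*) _"] cong: if_cong)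
    ultimately show ?thesis by simp
  qed
  then show ?thesis by (simp add: vec_eq_iff)
qed

lemma Ck_on_matrix_inv:
  fixes A :: "'a::real_normed_vector \<Rightarrow> real^'m^'m"
  assumes "open S" "Ck_on k S A" "\<And>x. x \<in> S \<Longrightarrow> invertible (A x)"
  shows "Ck_on k S (\<lambda>x. matrix_inv (A x))"
proof (rule Ck_on_cong[OF assms(1)])
  fix x assume "x \<in> S"
  show "(\<chi> i j. det (\<chi> a b. if b = i then axis j 1 $ a else A x $ a $ b) * inverse (det (A x)))
      = matrix_inv (A x)"
    by (simp add: matrix_inv_cramer[OF assms(3)[OF \<open>x \<in> S\<close>]] divide_inverse)
next
  have e: "Ck_on k S (\<lambda>x. if b = i then axis j 1 $ a else A x $ a $ b)" for a b i j
    by (cases "b = i") (simp_all add: Ck_on_const Ck_on_nth assms)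
  show "Ck_on k S (\<lambda>x. \<chi> i j. det (\<chi> a b. if b = i then axis j 1 $ a else A x $ a $ b) * inverse (det (A x)))"
    using assms(3)
    by (intro Ck_on_vec Ck_on_bilinear[OF _ bounded_bilinear_mult] Ck_on_det Ck_on_inverse e assms(1,2))
      (auto simp: invertible_det_nz)
qed


lemma Ck_on_jacobian:
  fixes f :: "real^'n::finite \<Rightarrow> real^'n"
  assumes "open S" "Ck_on (Suc k) S f"
  shows "Ck_on k S (\<lambda>x. jacobian f (at x))"
  unfolding jacobian_def matrix_def
  using assms by (intro Ck_on_vec Ck_on_nth) auto


section \<open>Complex vector spaces and algebras\<close>

class complex_vector = ab_group_add +
  fixes scaleC :: "complex \<Rightarrow> 'a \<Rightarrow> 'a" (infixr \<open>*\<^sub>C\<close> 75)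
  assumes scaleC_add_right: "a *\<^sub>C (x + y) = a *\<^sub>C x + a *\<^sub>C y"
    and scaleC_add_left: "(a + b) *\<^sub>C x = a *\<^sub>C x + b *\<^sub>C x"
    and scaleC_scaleC: "a *\<^sub>C (b *\<^sub>C x) = (a * b) *\<^sub>C x"
    and scaleC_one: "1 *\<^sub>C x = x"

global_interpretation cvec: vector_space "scaleC :: complex \<Rightarrow> 'a \<Rightarrow> 'a::complex_vector"
  defines cspan = cvec.span
  by unfold_locales (simp_all add: scaleC_add_right scaleC_add_left scaleC_scaleC scaleC_one)

abbreviation clinear :: "('a::complex_vector \<Rightarrow> 'b::complex_vector) \<Rightarrow> bool" where
  "clinear \<equiv> Vector_Spaces.linear scaleC scaleC"

lemma clinearI:
  assumes "\<And>x y. f (x + y) = f x + f y" "\<And>c x. f (c *\<^sub>C x) = c *\<^sub>C f x"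
  shows "clinear f"
  using assms by unfold_locales auto

(* The zero algebra is allowed: 0 = 1 is not excluded. *)
class complex_algebra_1 = complex_vector + ring + monoid_mult +
  assumes scaleC_mult_left: "(c *\<^sub>C x) * y = c *\<^sub>C (x * y)"
    and scaleC_mult_right: "x * (c *\<^sub>C y) = c *\<^sub>C (x * y)"

definition algebra_map :: "('a::complex_algebra_1 \<Rightarrow> 'b::complex_algebra_1) \<Rightarrow> bool" where
  "algebra_map f \<longleftrightarrow> clinear f \<and> f 1 = 1 \<and> (\<forall>x y. f (x * y) = f x * f y)"

definition finite_dimensional :: "'a::complex_vector itself \<Rightarrow> bool" where
  "finite_dimensional _ \<longleftrightarrow> (\<exists>B :: 'a set. finite B \<and> cspan B = UNIV)"

instantiation complex :: complex_algebra_1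
begin
definition scaleC_complex :: "complex \<Rightarrow> complex \<Rightarrow> complex" where
  "scaleC_complex c x = c * x"
instance by standard (simp_all add: scaleC_complex_def algebra_simps)
end

instantiation poly_mapping :: (type, complex_vector) complex_vector
begin
lift_definition scaleC_poly_mapping :: "complex \<Rightarrow> ('a \<Rightarrow>\<^sub>0 'b) \<Rightarrow> ('a \<Rightarrow>\<^sub>0 'b)"
  is "\<lambda>c x k. c *\<^sub>C x k"
  by (rule finite_subset[rotated]) (auto simp: cvec.scale_zero_right)
instance
  by standard (transfer, simp add: scaleC_add_right scaleC_add_left scaleC_scaleC scaleC_one)+
end

lemma lookup_scaleC: "Poly_Mapping.lookup (c *\<^sub>C x) k = c *\<^sub>C Poly_Mapping.lookup x k"
  by transfer simp


section \<open>Tensor products over the complex numbers\<close>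

text \<open>The quotient of the free vector space on \<open>'a \<times> 'b\<close> by the bilinearity relations.\<close>

definition tensor_rels :: "(('a::complex_vector \<times> 'b::complex_vector) \<Rightarrow>\<^sub>0 complex) set" where
  "tensor_rels =
     {Poly_Mapping.single (a + a', b) 1 - Poly_Mapping.single (a, b) 1 - Poly_Mapping.single (a', b) 1 | a a' b. True} \<union>
     {Poly_Mapping.single (a, b + b') 1 - Poly_Mapping.single (a, b) 1 - Poly_Mapping.single (a, b') 1 | a b b'. True} \<union>
     {Poly_Mapping.single (c *\<^sub>C a, b) 1 - Poly_Mapping.single (a, b) c | c a b. True} \<union>
     {Poly_Mapping.single (a, c *\<^sub>C b) 1 - Poly_Mapping.single (a, b) c | c a b. True}"

quotient_type (overloaded) ('a, 'b) tensor =
  "('a::complex_vector \<times> 'b::complex_vector) \<Rightarrow>\<^sub>0 complex" /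
  "\<lambda>x y. x - y \<in> cspan tensor_rels"
proof (rule equivpI)
  show "reflp (\<lambda>x y :: ('a \<times> 'b) \<Rightarrow>\<^sub>0 complex. x - y \<in> cspan tensor_rels)"
    by (simp add: reflp_def cvec.span_zero)
  show "symp (\<lambda>x y :: ('a \<times> 'b) \<Rightarrow>\<^sub>0 complex. x - y \<in> cspan tensor_rels)"
    by (metis (mono_tags, lifting) cvec.span_neg minus_diff_eq sympI)
  show "transp (\<lambda>x y :: ('a \<times> 'b) \<Rightarrow>\<^sub>0 complex. x - y \<in> cspan tensor_rels)"
  proof (rule transpI)
    fix x y z :: "('a \<times> 'b) \<Rightarrow>\<^sub>0 complex"
    assume "x - y \<in> cspan tensor_rels" "y - z \<in> cspan tensor_rels"
    then show "x - z \<in> cspan tensor_rels"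
      using cvec.span_add by fastforce
  qed
qed

instantiation tensor :: (complex_vector, complex_vector) complex_vector
begin
lift_definition zero_tensor :: "('a, 'b) tensor" is 0 .
lift_definition plus_tensor :: "('a, 'b) tensor \<Rightarrow> ('a, 'b) tensor \<Rightarrow> ('a, 'b) tensor" is "(+)"
  by (metis add_diff_add cvec.span_add)
lift_definition minus_tensor :: "('a, 'b) tensor \<Rightarrow> ('a, 'b) tensor \<Rightarrow> ('a, 'b) tensor" is "(-)"
  using cvec.span_diff by (fastforce simp: algebra_simps)
lift_definition uminus_tensor :: "('a, 'b) tensor \<Rightarrow> ('a, 'b) tensor" is uminus
  by (metis cvec.span_neg minus_diff_minus)
lift_definition scaleC_tensor :: "complex \<Rightarrow> ('a, 'b) tensor \<Rightarrow> ('a, 'b) tensor" is scaleC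
  by (metis cvec.scale_right_diff_distrib cvec.span_scale)
instance
  by standard (transfer, simp add: algebra_simps scaleC_add_right scaleC_add_left scaleC_scaleC
      scaleC_one cvec.span_zero)+
end

lift_definition tensor :: "'a::complex_vector \<Rightarrow> 'b::complex_vector \<Rightarrow> ('a, 'b) tensor" (infixr \<open>\<otimes>\<close> 73)
  is "\<lambda>a b. Poly_Mapping.single (a, b) 1" .

lemma tensor_add_left: "(a + a') \<otimes> b = a \<otimes> b + a' \<otimes> b"
proof transfer
  fix a a' :: 'a and b :: 'b
  have "Poly_Mapping.single (a + a', b) 1 - Poly_Mapping.single (a, b) 1 - Poly_Mapping.single (a', b) 1
    \<in> cspan tensor_rels" by (rule cvec.span_base, unfold tensor_rels_def, blast)
  then show "Poly_Mapping.single (a + a', b) 1 -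
     (Poly_Mapping.single (a, b) 1 + Poly_Mapping.single (a', b) 1) \<in> cspan tensor_rels"
    by (simp add: diff_diff_add)
qed

lemma tensor_add_right: "a \<otimes> (b + b') = a \<otimes> b + a \<otimes> b'"
proof transfer
  fix a :: 'a and b b' :: 'b
  have "Poly_Mapping.single (a, b + b') 1 - Poly_Mapping.single (a, b) 1 - Poly_Mapping.single (a, b') 1
    \<in> cspan tensor_rels" by (rule cvec.span_base, unfold tensor_rels_def, blast)
  then show "Poly_Mapping.single (a, b + b') 1 -
     (Poly_Mapping.single (a, b) 1 + Poly_Mapping.single (a, b') 1) \<in> cspan tensor_rels"
    by (simp add: diff_diff_add)
qed

lemma scaleC_single: "c *\<^sub>C Poly_Mapping.single k v = Poly_Mapping.single k (c *\<^sub>C v)"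
  by (rule poly_mapping_eqI) (simp add: lookup_scaleC lookup_single when_def)

lemma tensor_scaleC_left: "(c *\<^sub>C a) \<otimes> b = c *\<^sub>C (a \<otimes> b)"
proof transfer
  fix c and a :: 'a and b :: 'b
  have "Poly_Mapping.single (c *\<^sub>C a, b) 1 - Poly_Mapping.single (a, b) c \<in> cspan tensor_rels"
    by (rule cvec.span_base, unfold tensor_rels_def, blast)
  then show "Poly_Mapping.single (c *\<^sub>C a, b) 1 - c *\<^sub>C Poly_Mapping.single (a, b) 1
      \<in> cspan tensor_rels"
    by (simp add: scaleC_single scaleC_complex_def)
qed

lemma tensor_scaleC_right: "a \<otimes> (c *\<^sub>C b) = c *\<^sub>C (a \<otimes> b)"
proof transfer
  fix c and a :: 'a and b :: 'b
  have "Poly_Mapping.single (a, c *\<^sub>C b) 1 - Poly_Mapping.single (a, b) c \<in> cspan tensor_rels"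
    by (rule cvec.span_base, unfold tensor_rels_def, blast)
  then show "Poly_Mapping.single (a, c *\<^sub>C b) 1 - c *\<^sub>C Poly_Mapping.single (a, b) 1
      \<in> cspan tensor_rels"
    by (simp add: scaleC_single scaleC_complex_def)
qed

definition cbilinear :: "('a::complex_vector \<Rightarrow> 'b::complex_vector \<Rightarrow> 'c::complex_vector) \<Rightarrow> bool" where
  "cbilinear f \<longleftrightarrow> (\<forall>b. clinear (\<lambda>a. f a b)) \<and> (\<forall>a. clinear (f a))"

definition free_lift :: "('k \<Rightarrow> 'c::complex_vector) \<Rightarrow> ('k \<Rightarrow>\<^sub>0 complex) \<Rightarrow> 'c" where
  "free_lift f x = (\<Sum>k\<in>Poly_Mapping.keys x. Poly_Mapping.lookup x k *\<^sub>C f k)"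

text \<open>The linear map with \<open>a \<otimes> b \<mapsto> f a b\<close>; meaningful for bilinear \<open>f\<close> only.\<close>

definition tensor_lift ::
  "('a::complex_vector \<Rightarrow> 'b::complex_vector \<Rightarrow> 'c::complex_vector) \<Rightarrow> ('a, 'b) tensor \<Rightarrow> 'c" where
  "tensor_lift f t = free_lift (\<lambda>(a, b). f a b) (rep_tensor t)"

lemma free_lift_superset:
  assumes "finite S" "Poly_Mapping.keys x \<subseteq> S"
  shows "free_lift f x = (\<Sum>k\<in>S. Poly_Mapping.lookup x k *\<^sub>C f k)"
  unfolding free_lift_def using assms
  by (intro sum.mono_neutral_left) (auto simp: in_keys_iff)

lemma free_lift_add: "free_lift f (x + y) = free_lift f x + free_lift f y"
proof -
  let ?S = "Poly_Mapping.keys x \<union> Poly_Mapping.keys y"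
  have "free_lift f (x + y) = (\<Sum>k\<in>?S. Poly_Mapping.lookup (x + y) k *\<^sub>C f k)"
    using keys_add[of x y] by (intro free_lift_superset) auto
  then show ?thesis
    by (simp add: lookup_add scaleC_add_left sum.distrib free_lift_superset[of ?S])
qed

lemma free_lift_scaleC: "free_lift f (c *\<^sub>C x) = c *\<^sub>C free_lift f x"
proof -
  have "free_lift f (c *\<^sub>C x) = (\<Sum>k\<in>Poly_Mapping.keys x. Poly_Mapping.lookup (c *\<^sub>C x) k *\<^sub>C f k)"
    by (intro free_lift_superset) (auto simp: in_keys_iff lookup_scaleC scaleC_complex_def)
  then show ?thesis
    by (simp add: lookup_scaleC scaleC_complex_def scaleC_scaleC free_lift_def cvec.scale_sum_right)
qed

lemma clinear_free_lift: "clinear (free_lift f)"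
  by (rule clinearI) (simp_all add: free_lift_add free_lift_scaleC)

lemma clinear_diff:
  assumes "clinear f" shows "f (x - y) = f x - f y"
proof -
  interpret Vector_Spaces.linear scaleC scaleC f by fact
  show ?thesis by (rule diff)
qed

lemma free_lift_single [simp]: "free_lift f (Poly_Mapping.single k c) = c *\<^sub>C f k"
  by (cases "c = 0") (simp_all add: free_lift_def)

lemma free_lift_tensor_rels:
  assumes "cbilinear f" "x \<in> cspan tensor_rels"
  shows "free_lift (\<lambda>(a, b). f a b) x = 0"
proof -
  have l: "clinear (\<lambda>a. f a b)" "clinear (f a)" for a b using assms(1) by (auto simp: cbilinear_def)
  have add: "f (a + a') b = f a b + f a' b" "f a (b + b') = f a b + f a b'" 
    and sc: "f (c *\<^sub>C a) b = c *\<^sub>C f a b" "f a (c *\<^sub>C b) = c *\<^sub>C f a b" for a a' b b' c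
    using l(1)[of b] l(2)[of a]
    by (simp_all add: Vector_Spaces.linear_iff)
  show ?thesis
    using assms(2)
  proof (induction rule: cvec.span_induct_alt)
    case base
    then show ?case by (simp add: free_lift_def)
  next
    case (step c x y)
    have "free_lift (\<lambda>(a, b). f a b) x = 0"
      using step(1) unfolding tensor_rels_def
      by (auto simp: clinear_diff[OF clinear_free_lift] add sc scaleC_one)
    then show ?case using step by (simp add: free_lift_add free_lift_scaleC)
  qed
qed

lemma tensor_lift_abs:
  assumes "cbilinear f"
  shows "tensor_lift f (abs_tensor x) = free_lift (\<lambda>(a, b). f a b) x"
proof -
  have "rep_tensor (abs_tensor x) - x \<in> cspan tensor_rels"
    using cvec.span_zero by (intro rep_abs_rsp_left[OF Quotient3_tensor]) simp
  then have "free_lift (\<lambda>(a, b). f a b) (rep_tensor (abs_tensor x) - x) = 0"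
    by (rule free_lift_tensor_rels[OF assms])
  then show ?thesis by (simp add: tensor_lift_def clinear_diff[OF clinear_free_lift])
qed

lemma tensor_lift_tensor: "cbilinear f \<Longrightarrow> tensor_lift f (a \<otimes> b) = f a b"
  by (simp add: tensor.abs_eq tensor_lift_abs scaleC_one)

lemma abs_tensor_surj: obtains x where "t = abs_tensor x"
  using Quotient3_abs_rep[OF Quotient3_tensor] by metis

lemma clinear_tensor_lift:
  assumes "cbilinear f"
  shows "clinear (tensor_lift f)"
proof (rule clinearI)
  show "tensor_lift f (x + y) = tensor_lift f x + tensor_lift f y" for x y
    by (rule abs_tensor_surj[of x], rule abs_tensor_surj[of y])
      (simp add: plus_tensor.abs_eq tensor_lift_abs[OF assms] free_lift_add)
  show "tensor_lift f (c *\<^sub>C x) = c *\<^sub>C tensor_lift f x" for c x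
    by (rule abs_tensor_surj[of x]) (simp add: scaleC_tensor.abs_eq tensor_lift_abs[OF assms] free_lift_scaleC)
qed

lemma tensor_induct [case_names zero tensor add]:
  assumes "P 0" "\<And>a b. P (a \<otimes> b)" "\<And>x y. P x \<Longrightarrow> P y \<Longrightarrow> P (x + y)"
  shows "P t"
proof -
  obtain x where abs_tensor: "t = abs_tensor x" by (rule abs_tensor_surj)
  have single: "P (abs_tensor (Poly_Mapping.single k v))" for k v
  proof -
    have "abs_tensor (Poly_Mapping.single k v) = (v *\<^sub>C fst k) \<otimes> snd k"
      unfolding tensor_scaleC_left
      by (simp add: tensor.abs_eq scaleC_tensor.abs_eq scaleC_single scaleC_complex_def)
    then show ?thesis using assms(2) by simp
  qed
  have "P (abs_tensor (\<Sum>k\<in>S. Poly_Mapping.single k (Poly_Mapping.lookup x k)))" for S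
    by (induction S rule: infinite_finite_induct)
      (simp_all add: assms(1) assms(3) single flip: zero_tensor_def plus_tensor.abs_eq)
  moreover have "(\<Sum>k\<in>Poly_Mapping.keys x. Poly_Mapping.single k (Poly_Mapping.lookup x k)) = x"
    by (rule poly_mapping_eqI)
      (simp add: lookup_sum lookup_single when_def in_keys_iff)
  ultimately show ?thesis using abs_tensor by metis
qed

instantiation tensor :: (complex_algebra_1, complex_algebra_1) complex_algebra_1
begin

definition one_tensor :: "('a, 'b) tensor" where "one_tensor = 1 \<otimes> 1"

definition times_tensor :: "('a, 'b) tensor \<Rightarrow> ('a, 'b) tensor \<Rightarrow> ('a, 'b) tensor" where
  "times_tensor t u = tensor_lift (\<lambda>a b. tensor_lift (\<lambda>c d. (a * c) \<otimes> (b * d)) u) t"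

lemma cbilinear_times_tensor1: "cbilinear (\<lambda>c d. ((a::'a) * c) \<otimes> ((b::'b) * d))"
  unfolding cbilinear_def
  by (auto intro!: clinearI simp: distrib_left tensor_add_left tensor_add_right scaleC_mult_right
      tensor_scaleC_left tensor_scaleC_right)

lemma cbilinear_times_tensor2:
  "cbilinear (\<lambda>(a::'a) (b::'b). tensor_lift (\<lambda>c d. (a * c) \<otimes> (b * d)) u)"
proof (induction u rule: tensor_induct)
  case zero
  have "tensor_lift (\<lambda>c d. (a * c) \<otimes> (b * d)) (0 :: ('a, 'b) tensor) = 0" for a b
    using clinear_diff[OF clinear_tensor_lift[OF cbilinear_times_tensor1], of a b 0 0] by simp
  then show ?case by (auto simp: cbilinear_def intro!: clinearI)
next
  case (tensor c d)
  show ?case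
    unfolding tensor_lift_tensor[OF cbilinear_times_tensor1] cbilinear_def
    by (auto intro!: clinearI simp: distrib_right tensor_add_left tensor_add_right scaleC_mult_left
      tensor_scaleC_left tensor_scaleC_right)
next
  case (add x y)
  have "tensor_lift (\<lambda>c d. (a * c) \<otimes> (b * d)) (x + y) =
      tensor_lift (\<lambda>c d. (a * c) \<otimes> (b * d)) x + tensor_lift (\<lambda>c d. (a * c) \<otimes> (b * d)) y" for a b
    using clinear_tensor_lift[OF cbilinear_times_tensor1] by (simp add: Vector_Spaces.linear_iff)
  with add show ?case
    by (simp add: cbilinear_def Vector_Spaces.linear_iff algebra_simps)
qed

lemma times_tensor_tensor: "(a \<otimes> b) * (c \<otimes> d) = ((a::'a) * c) \<otimes> ((b::'b) * d)"
  unfolding times_tensor_def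
  by (subst tensor_lift_tensor[OF cbilinear_times_tensor2]) (rule tensor_lift_tensor[OF cbilinear_times_tensor1])

lemma clinear_times_tensor_left: "clinear (\<lambda>t. t * (u :: ('a, 'b) tensor))"
  unfolding times_tensor_def by (rule clinear_tensor_lift[OF cbilinear_times_tensor2])

lemma clinear_times_tensor_right: "clinear (\<lambda>u. (t :: ('a, 'b) tensor) * u)"
proof (induction t rule: tensor_induct)
  case zero
  have "0 * u = 0" for u :: "('a, 'b) tensor"
    using clinear_diff[OF clinear_times_tensor_left, of 0 0 u] by simp
  then show ?case by (auto intro!: clinearI)
next
  case (tensor a b)
  show ?case unfolding times_tensor_def tensor_lift_tensor[OF cbilinear_times_tensor2]
    by (rule clinear_tensor_lift[OF cbilinear_times_tensor1])
next
  case (add x y)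
  have "(x + y) * u = x * u + y * u" for u
    using clinear_times_tensor_left[of u] by (simp add: Vector_Spaces.linear_iff)
  with add show ?case by (simp add: Vector_Spaces.linear_iff algebra_simps)
qed

instance
proof
  fix x y z :: "('a, 'b) tensor" and c :: complex
  show r: "(x + y) * z = x * z + y * z" for x y z :: "('a, 'b) tensor"
    using clinear_times_tensor_left[of z] by (simp add: Vector_Spaces.linear_iff)
  show "(c *\<^sub>C x) * y = c *\<^sub>C (x * y)"
    using clinear_times_tensor_left[of y] by (simp add: Vector_Spaces.linear_iff)
  show l: "x * (y + z) = x * y + x * z" for x y z :: "('a, 'b) tensor"
    using clinear_times_tensor_right[of x] by (simp add: Vector_Spaces.linear_iff)
  show "x * (c *\<^sub>C y) = c *\<^sub>C (x * y)"
    using clinear_times_tensor_right[of x] by (simp add: Vector_Spaces.linear_iff)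
  have z: "0 * u = 0" "u * 0 = 0" for u :: "('a, 'b) tensor"
    using clinear_diff[OF clinear_times_tensor_left, of 0 0 u]
      clinear_diff[OF clinear_times_tensor_right, of u 0 0] by simp_all
  show "1 * x = x"
    by (induction x rule: tensor_induct) (simp_all add: one_tensor_def times_tensor_tensor l z)
  show "x * 1 = x"
    by (induction x rule: tensor_induct) (simp_all add: one_tensor_def times_tensor_tensor r z)
  show "x * y * z = x * (y * z)"
  proof (induction x rule: tensor_induct)
    case (tensor a b)
    show ?case
    proof (induction y rule: tensor_induct)
      case (tensor c d)
      show ?case
        by (induction z rule: tensor_induct) (simp_all add: times_tensor_tensor mult.assoc l z)
    qed (simp_all add: l r z)
  qed (simp_all add: r z)
qed

end

definition tensor_map ::
  "('a::complex_vector \<Rightarrow> 'c::complex_vector) \<Rightarrow> ('b::complex_vector \<Rightarrow> 'd::complex_vector)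
    \<Rightarrow> ('a, 'b) tensor \<Rightarrow> ('c, 'd) tensor" where
  "tensor_map f g = tensor_lift (\<lambda>a b. f a \<otimes> g b)"

definition tensor_assoc ::
  "(('a::complex_vector, 'b::complex_vector) tensor, 'c::complex_vector) tensor
    \<Rightarrow> ('a, ('b, 'c) tensor) tensor" where
  "tensor_assoc = tensor_lift (\<lambda>t c. tensor_lift (\<lambda>a b. a \<otimes> (b \<otimes> c)) t)"


text \<open>Comodules over a bialgebra \<open>'h\<close> with coproduct \<open>\<Delta>\<close> and counit \<open>\<epsilon>\<close>.\<close>

definition right_comodule ::
  "('h::complex_vector \<Rightarrow> ('h, 'h) tensor) \<Rightarrow> ('h \<Rightarrow> complex) \<Rightarrow>
    ('a::complex_vector \<Rightarrow> ('a, 'h) tensor) \<Rightarrow> bool" where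
  "right_comodule \<Delta> \<epsilon> \<rho> \<longleftrightarrow> clinear \<rho> \<and>
     (\<forall>a. tensor_assoc (tensor_map \<rho> id (\<rho> a)) = tensor_map id \<Delta> (\<rho> a)) \<and>
     (\<forall>a. tensor_lift (\<lambda>a' h. \<epsilon> h *\<^sub>C a') (\<rho> a) = a)"

definition right_comodule_algebra ::
  "('h::complex_algebra_1 \<Rightarrow> ('h, 'h) tensor) \<Rightarrow> ('h \<Rightarrow> complex) \<Rightarrow>
    ('a::complex_algebra_1 \<Rightarrow> ('a, 'h) tensor) \<Rightarrow> bool" where
  "right_comodule_algebra \<Delta> \<epsilon> \<rho> \<longleftrightarrow> right_comodule \<Delta> \<epsilon> \<rho> \<and> algebra_map \<rho>"

definition trivial_coaction ::
  "('a::complex_algebra_1 \<Rightarrow> ('a, 'h::complex_algebra_1) tensor) \<Rightarrow> bool" where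
  "trivial_coaction \<rho> \<longleftrightarrow> (\<forall>a. \<rho> a = a \<otimes> 1)"

definition total_integral ::
  "('h::complex_algebra_1 \<Rightarrow> ('h, 'h) tensor) \<Rightarrow> ('a::complex_algebra_1 \<Rightarrow> ('a, 'h) tensor) \<Rightarrow>
    ('h \<Rightarrow> 'a) \<Rightarrow> bool" where
  "total_integral \<Delta> \<rho> f \<longleftrightarrow> clinear f \<and> f 1 = 1 \<and> (\<forall>h. tensor_map f id (\<Delta> h) = \<rho> (f h))"


section \<open>The frame bundle and its compactly supported smooth functions\<close>

text \<open>A point is a pair \<open>(x, y)\<close>, where the coordinate \<open>y\<^sup>\<mu>\<^sub>j\<close> is the matrix entry
  \<open>y $ \<mu> $ j\<close>.\<close>

type_synonym 'n frame = "(real^'n) \<times> (real^'n^'n)"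

definition frame_bundle :: "'n::finite frame set" where
  "frame_bundle = {(x, y). invertible y}"

lemma open_frame_bundle: "open (frame_bundle :: 'n::finite frame set)"
proof -
  have "Ck_on 0 UNIV (\<lambda>p :: 'n frame. det (snd p))"
    by (intro Ck_on_det open_UNIV Ck_on_linear bounded_linear_snd)
  then have "open ((\<lambda>p :: 'n frame. det (snd p)) -` (- {0}))"
    by (intro open_vimage) auto
  moreover have "(\<lambda>p :: 'n frame. det (snd p)) -` (- {0}) = frame_bundle"
    by (auto simp: frame_bundle_def invertible_det_nz)
  ultimately show ?thesis by simp
qed

text \<open>Functions on the frame bundle are extended by \<open>0\<close> to singular matrices \<open>y\<close>.\<close>

definition compact_smooth :: "('n::finite frame \<Rightarrow> complex) \<Rightarrow> bool" where
  "compact_smooth g \<longleftrightarrow> smooth_on frame_bundle g \<and>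
     (\<exists>K. compact K \<and> K \<subseteq> frame_bundle \<and> (\<forall>p. p \<notin> K \<longrightarrow> g p = 0))"

lemma compact_smooth_zero: "compact_smooth (\<lambda>p. 0)"
  unfolding compact_smooth_def smooth_on_def
  by (auto intro: Ck_on_const open_frame_bundle)

lemma compact_smooth_add:
  assumes "compact_smooth f" "compact_smooth g"
  shows "compact_smooth (\<lambda>p. f p + g p)"
proof -
  obtain K L where "compact K" "K \<subseteq> frame_bundle" "\<forall>p. p \<notin> K \<longrightarrow> f p = 0"
    "compact L" "L \<subseteq> frame_bundle" "\<forall>p. p \<notin> L \<longrightarrow> g p = 0"
    using assms unfolding compact_smooth_def by auto
  then have "compact (K \<union> L) \<and> K \<union> L \<subseteq> frame_bundle \<and> (\<forall>p. p \<notin> K \<union> L \<longrightarrow> f p + g p = 0)"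
    by auto
  then show ?thesis
    using assms unfolding compact_smooth_def smooth_on_def
    by (blast intro: Ck_on_add open_frame_bundle)
qed

lemma compact_smooth_bilinear:
  assumes "smooth_on frame_bundle f" "compact_smooth g"
    and "bounded_bilinear p"
  shows "compact_smooth (\<lambda>z. p (f z) (g z))"
proof -
  have "smooth_on frame_bundle (\<lambda>z. p (f z) (g z))"
    using assms(1,2) unfolding compact_smooth_def smooth_on_def
    by (blast intro: Ck_on_bilinear[OF open_frame_bundle assms(3)])
  moreover obtain K where "compact K" "K \<subseteq> frame_bundle" "\<forall>p. p \<notin> K \<longrightarrow> g p = 0"
    using assms(2) unfolding compact_smooth_def by auto
  ultimately show ?thesis
    using bounded_bilinear.zero_right[OF assms(3)] unfolding compact_smooth_def by metis
qed

lemma compact_smooth_scaleC: "compact_smooth g \<Longrightarrow> compact_smooth (\<lambda>p. c * g p)"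
  using compact_smooth_bilinear[of "\<lambda>p. c" g "(*)"]
  by (simp add: smooth_on_def Ck_on_const open_frame_bundle bounded_bilinear_mult)

lemma compact_smooth_scaleR:
  "smooth_on frame_bundle h \<Longrightarrow> compact_smooth g \<Longrightarrow> compact_smooth (\<lambda>p. h p *\<^sub>R g p)"
  by (rule compact_smooth_bilinear[OF _ _ bounded_bilinear_scaleR])

lemma compact_smooth_sum:
  "(\<And>i. i \<in> I \<Longrightarrow> compact_smooth (f i)) \<Longrightarrow> compact_smooth (\<lambda>p. \<Sum>i\<in>I. f i p)"
  by (induction I rule: infinite_finite_induct) (auto intro: compact_smooth_zero compact_smooth_add)

lemma compact_smooth_has_derivative:
  assumes "compact_smooth g"
  shows "(g has_derivative frechet_derivative g (at p)) (at p)"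
proof (cases "p \<in> frame_bundle")
  case True
  then show ?thesis using assms Ck_on_has_derivative
    unfolding compact_smooth_def smooth_on_def by blast
next
  case False
  obtain K where K: "compact K" "K \<subseteq> frame_bundle" "\<forall>p. p \<notin> K \<longrightarrow> g p = 0"
    using assms unfolding compact_smooth_def by auto
  have "(g has_derivative (\<lambda>_. 0)) (at p)"
  proof (rule has_derivative_transform_within_open)
    show "((\<lambda>_. 0) has_derivative (\<lambda>_. 0)) (at p)" by (rule has_derivative_const)
    show "open (- K)" using K(1) by (simp add: compact_imp_closed open_Compl)
  qed (use K False in auto)
  then show ?thesis using frechet_derivativeI by metis
qed

lemma compact_smooth_frechet_derivative:
  assumes "compact_smooth g"
  shows "compact_smooth (\<lambda>p. frechet_derivative g (at p) v)"
proof -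
  obtain K where K: "compact K" "K \<subseteq> frame_bundle" "\<forall>p. p \<notin> K \<longrightarrow> g p = 0"
    using assms unfolding compact_smooth_def by auto
  have "frechet_derivative g (at p) v = 0" if "p \<notin> K" for p
  proof -
    have "(g has_derivative (\<lambda>_. 0)) (at p)"
    proof (rule has_derivative_transform_within_open)
      show "((\<lambda>_. 0) has_derivative (\<lambda>_. 0)) (at p)" by (rule has_derivative_const)
      show "open (- K)" using K(1) by (simp add: compact_imp_closed open_Compl)
    qed (use K that in auto)
    then show ?thesis using frechet_derivativeI by fastforce
  qed
  moreover have "smooth_on frame_bundle (\<lambda>p. frechet_derivative g (at p) v)"
    unfolding smooth_on_def
  proof
    fix k
    have "Ck_on (Suc k) frame_bundle g"
      using assms by (simp add: compact_smooth_def smooth_on_def del: Ck_on.simps)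
    then show "Ck_on k frame_bundle (\<lambda>p. frechet_derivative g (at p) v)"
      unfolding Ck_on.simps(2) by blast
  qed
  ultimately show ?thesis using K unfolding compact_smooth_def by blast
qed

definition vector_field_X :: "'n \<Rightarrow> ('n::finite frame \<Rightarrow> complex) \<Rightarrow> 'n frame \<Rightarrow> complex" where
  "vector_field_X k g = (\<lambda>(x, y). \<Sum>\<mu>\<in>UNIV.
     y $ \<mu> $ k *\<^sub>R frechet_derivative g (at (x, y)) (axis \<mu> 1, 0))"

definition vector_field_Y :: "'n \<Rightarrow> 'n \<Rightarrow> ('n::finite frame \<Rightarrow> complex) \<Rightarrow> 'n frame \<Rightarrow> complex" where
  "vector_field_Y i j g = (\<lambda>(x, y). \<Sum>\<mu>\<in>UNIV.
     y $ \<mu> $ i *\<^sub>R frechet_derivative g (at (x, y)) (0, axis \<mu> (axis j 1)))"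

lemma smooth_frame_coord: "smooth_on frame_bundle (\<lambda>p :: 'n::finite frame. snd p $ \<mu> $ k)"
  unfolding smooth_on_def
  by (intro allI Ck_on_nth Ck_on_linear open_frame_bundle bounded_linear_snd)

lemma compact_smooth_X: "compact_smooth g \<Longrightarrow> compact_smooth (vector_field_X k g)"
  unfolding vector_field_X_def case_prod_beta prod.collapse
  by (intro compact_smooth_sum compact_smooth_scaleR smooth_frame_coord
      compact_smooth_frechet_derivative)

lemma compact_smooth_Y: "compact_smooth g \<Longrightarrow> compact_smooth (vector_field_Y i j g)"
  unfolding vector_field_Y_def case_prod_beta prod.collapse
  by (intro compact_smooth_sum compact_smooth_scaleR smooth_frame_coord
      compact_smooth_frechet_derivative)

lemma frechet_derivative_add:
  assumes "compact_smooth f" "compact_smooth g"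
  shows "frechet_derivative (\<lambda>p. f p + g p) (at p) v =
    frechet_derivative f (at p) v + frechet_derivative g (at p) v"
  using frechet_derivativeI[OF has_derivative_add[OF compact_smooth_has_derivative[OF assms(1), of p]
      compact_smooth_has_derivative[OF assms(2), of p]]] by simp

lemma frechet_derivative_cmult:
  assumes "compact_smooth f"
  shows "frechet_derivative (\<lambda>p. c * f p) (at p) v = c * frechet_derivative f (at p) v"
  using frechet_derivativeI[OF has_derivative_mult_right[OF compact_smooth_has_derivative[OF assms, of p]]]
  by simp

lemma vector_field_X_add:
  "compact_smooth f \<Longrightarrow> compact_smooth g \<Longrightarrow>
    vector_field_X k (\<lambda>p. f p + g p) p = vector_field_X k f p + vector_field_X k g p"
  by (cases p) (simp add: vector_field_X_def frechet_derivative_add algebra_simps sum.distrib)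

lemma vector_field_Y_add:
  "compact_smooth f \<Longrightarrow> compact_smooth g \<Longrightarrow>
    vector_field_Y i j (\<lambda>p. f p + g p) p = vector_field_Y i j f p + vector_field_Y i j g p"
  by (cases p) (simp add: vector_field_Y_def frechet_derivative_add algebra_simps sum.distrib)

lemma vector_field_X_cmult:
  "compact_smooth f \<Longrightarrow> vector_field_X k (\<lambda>p. c * f p) p = c * vector_field_X k f p"
  by (cases p) (simp add: vector_field_X_def frechet_derivative_cmult sum_distrib_left)

lemma vector_field_Y_cmult:
  "compact_smooth f \<Longrightarrow> vector_field_Y i j (\<lambda>p. c * f p) p = c * vector_field_Y i j f p"
  by (cases p) (simp add: vector_field_Y_def frechet_derivative_cmult sum_distrib_left)

typedef ('n::finite) frame_fun = "{g :: 'n frame \<Rightarrow> complex. compact_smooth g}"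
  morphisms frame_eval Frame_Fun
  using compact_smooth_zero by auto

setup_lifting type_definition_frame_fun

instantiation frame_fun :: (finite) complex_vector
begin
lift_definition zero_frame_fun :: "'a frame_fun" is "\<lambda>p. 0"
  by (rule compact_smooth_zero)
lift_definition plus_frame_fun :: "'a frame_fun \<Rightarrow> 'a frame_fun \<Rightarrow> 'a frame_fun"
  is "\<lambda>f g p. f p + g p"
  by (rule compact_smooth_add)
lift_definition scaleC_frame_fun :: "complex \<Rightarrow> 'a frame_fun \<Rightarrow> 'a frame_fun"
  is "\<lambda>c f p. c * f p"
  by (rule compact_smooth_scaleC)
definition uminus_frame_fun :: "'a frame_fun \<Rightarrow> 'a frame_fun" where
  "uminus_frame_fun f = (- 1) *\<^sub>C f"
definition minus_frame_fun :: "'a frame_fun \<Rightarrow> 'a frame_fun \<Rightarrow> 'a frame_fun" where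
  "minus_frame_fun f g = f + - g"
instance
proof
  fix a b c :: "'a frame_fun" and z w :: complex
  show "a + b + c = a + (b + c)" by transfer (simp add: add.assoc)
  show "a + b = b + a" by transfer (simp add: add.commute)
  show "0 + a = a" by transfer simp
  show "- a + a = 0" unfolding uminus_frame_fun_def by transfer simp
  show "a - b = a + - b" by (rule minus_frame_fun_def)
  show "z *\<^sub>C (a + b) = z *\<^sub>C a + z *\<^sub>C b" by transfer (simp add: distrib_left)
  show "(z + w) *\<^sub>C a = z *\<^sub>C a + w *\<^sub>C a" by transfer (simp add: distrib_right)
  show "z *\<^sub>C w *\<^sub>C a = (z * w) *\<^sub>C a" by transfer (simp add: mult.assoc)
  show "1 *\<^sub>C a = a" by transfer simp
qed
end

lift_definition frame_mult :: "'n::finite frame_fun \<Rightarrow> 'n frame_fun \<Rightarrow> 'n frame_fun"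
  is "\<lambda>f g p. f p * g p"
  by (rule compact_smooth_bilinear[OF _ _ bounded_bilinear_mult]) (simp_all add: compact_smooth_def)

lift_definition frame_X :: "'n \<Rightarrow> 'n::finite frame_fun \<Rightarrow> 'n frame_fun" is vector_field_X
  by (rule compact_smooth_X)

lift_definition frame_Y :: "'n \<Rightarrow> 'n \<Rightarrow> 'n::finite frame_fun \<Rightarrow> 'n frame_fun" is vector_field_Y
  by (rule compact_smooth_Y)


section \<open>Diffeomorphisms\<close>

lemma diffeo_id_props:
  "bij (\<lambda>x. x) \<and> smooth_on UNIV (\<lambda>x :: real^'n::finite. x) \<and> smooth_on UNIV (inv (\<lambda>x :: real^'n. x))"
proof -
  have "smooth_on UNIV (\<lambda>x :: real^'n. x)"
    unfolding smooth_on_def using Ck_on_linear[OF open_UNIV bounded_linear_ident] by blast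
  moreover have "inv (\<lambda>x :: real^'n. x) = (\<lambda>x. x)" by (rule inv_id[unfolded id_def])
  ultimately show ?thesis using bij_id[unfolded id_def] by metis
qed

typedef ('n::finite) diffeo =
  "{\<phi> :: real^'n \<Rightarrow> real^'n. bij \<phi> \<and> smooth_on UNIV \<phi> \<and> smooth_on UNIV (inv \<phi>)}"
  morphisms diffeo_apply Diffeo
  using diffeo_id_props by blast

setup_lifting type_definition_diffeo

lift_definition diffeo_id :: "'n::finite diffeo" is "\<lambda>x. x"
  by (rule diffeo_id_props)

lift_definition diffeo_comp :: "'n::finite diffeo \<Rightarrow> 'n diffeo \<Rightarrow> 'n diffeo" is "(\<circ>)"
proof (intro conjI; elim conjE)
  fix \<phi> \<psi> :: "real^'n \<Rightarrow> real^'n"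
  assume "bij \<phi>" "bij \<psi>" and s: "smooth_on UNIV \<phi>" "smooth_on UNIV (inv \<phi>)"
    "smooth_on UNIV \<psi>" "smooth_on UNIV (inv \<psi>)"
  then show "bij (\<phi> \<circ> \<psi>)" by (intro bij_comp)
  have "smooth_on UNIV (f \<circ> g)" if "smooth_on UNIV f" "smooth_on UNIV g" for f g :: "real^'n \<Rightarrow> real^'n"
    using that Ck_on_compose[of UNIV _ g UNIV f] by (simp add: smooth_on_def o_def)
  then show "smooth_on UNIV (\<phi> \<circ> \<psi>)" "smooth_on UNIV (inv (\<phi> \<circ> \<psi>))"
    using s \<open>bij \<phi>\<close> \<open>bij \<psi>\<close> by (simp_all add: o_inv_distrib)
qed

text \<open>The prolongation of a diffeomorphism to the frame bundle.\<close>

definition prolong :: "(real^'n \<Rightarrow> real^'n) \<Rightarrow> 'n::finite frame \<Rightarrow> 'n frame" where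
  "prolong \<phi> = (\<lambda>(x, y). (\<phi> x, jacobian \<phi> (at x) ** y))"

definition gamma :: "'n \<Rightarrow> 'n \<Rightarrow> 'n \<Rightarrow> (real^'n \<Rightarrow> real^'n) \<Rightarrow> 'n::finite frame \<Rightarrow> real" where
  "gamma i j k \<phi> = (\<lambda>(x, y). \<Sum>\<mu>\<in>UNIV.
     (matrix_inv y ** matrix_inv (jacobian \<phi> (at x)) **
       frechet_derivative (\<lambda>z. jacobian \<phi> (at z)) (at x) (axis \<mu> 1) ** y) $ i $ j * y $ \<mu> $ k)"

lemma jacobian_chain:
  fixes f g :: "real^'n::finite \<Rightarrow> real^'n"
  assumes "g differentiable (at x)" "f differentiable (at (g x))"
  shows "jacobian (\<lambda>x. f (g x)) (at x) = jacobian f (at (g x)) ** jacobian g (at x)"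
proof -
  have "((\<lambda>x. f (g x)) has_derivative (\<lambda>v. frechet_derivative f (at (g x)) (frechet_derivative g (at x) v))) (at x)"
    using assms frechet_derivative_works has_derivative_compose by blast
  then have "frechet_derivative (\<lambda>x. f (g x)) (at x) =
      frechet_derivative f (at (g x)) \<circ> frechet_derivative g (at x)"
    by (simp add: frechet_derivativeI o_def)
  then show ?thesis
    unfolding jacobian_def using assms
    by (simp add: matrix_compose linear_frechet_derivative)
qed

lemma jacobian_diffeo_inv:
  fixes \<phi> :: "real^'n::finite \<Rightarrow> real^'n"
  assumes "bij \<phi>" "smooth_on UNIV \<phi>" "smooth_on UNIV (inv \<phi>)"
  shows "jacobian (inv \<phi>) (at (\<phi> x)) ** jacobian \<phi> (at x) = mat 1"
proof -
  have d: "f differentiable (at x)" if "smooth_on UNIV f" for f :: "real^'n \<Rightarrow> real^'n" and x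
    using that unfolding smooth_on_def by (metis Ck_on.simps(2) UNIV_I)
  have "jacobian (\<lambda>x. inv \<phi> (\<phi> x)) (at x) = jacobian (inv \<phi>) (at (\<phi> x)) ** jacobian \<phi> (at x)"
    using assms by (intro jacobian_chain d)
  moreover have "(\<lambda>x. inv \<phi> (\<phi> x)) = (\<lambda>x. x)"
    using assms(1) by (auto simp: bij_def inv_f_f)
  moreover have "jacobian (\<lambda>x :: real^'n. x) (at x) = mat 1"
    using frechet_derivativeI[OF has_derivative_ident, of x] matrix_id_mat_1
    by (simp add: jacobian_def id_def)
  ultimately show ?thesis by simp
qed

lemma invertible_jacobian_diffeo:
  fixes \<phi> :: "real^'n::finite \<Rightarrow> real^'n"
  assumes "bij \<phi>" "smooth_on UNIV \<phi>" "smooth_on UNIV (inv \<phi>)"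
  shows "invertible (jacobian \<phi> (at x))"
  using jacobian_diffeo_inv[OF assms, of x] by (auto simp: invertible_left_inverse)

lemma Ck_on_frame_fst:
  assumes "Ck_on k UNIV (h :: real^'n::finite \<Rightarrow> 'c::real_normed_vector)"
  shows "Ck_on k frame_bundle (\<lambda>p :: 'n frame. h (fst p))"
  by (rule Ck_on_compose[OF open_frame_bundle _ assms])
    (auto intro: Ck_on_linear open_frame_bundle bounded_linear_fst)

lemma smooth_gamma:
  fixes \<phi> :: "real^'n::finite \<Rightarrow> real^'n"
  assumes "bij \<phi>" "smooth_on UNIV \<phi>" "smooth_on UNIV (inv \<phi>)"
  shows "smooth_on frame_bundle (gamma i j k \<phi>)"
  unfolding smooth_on_def
proof
  fix m
  have J: "Ck_on l UNIV (\<lambda>x. jacobian \<phi> (at x))" for l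
    using assms(2) by (intro Ck_on_jacobian open_UNIV) (simp add: smooth_on_def del: Ck_on.simps)
  have DJ: "Ck_on m UNIV (\<lambda>x. frechet_derivative (\<lambda>z. jacobian \<phi> (at z)) (at x) v)" for v
    using J[of "Suc m"] by simp
  have y: "Ck_on m frame_bundle (\<lambda>p :: 'n frame. snd p)"
    by (intro Ck_on_linear open_frame_bundle bounded_linear_snd)
  show "Ck_on m frame_bundle (gamma i j k \<phi>)"
    unfolding gamma_def case_prod_beta
    by (intro Ck_on_sum Ck_on_bilinear[OF _ bounded_bilinear_mult] Ck_on_nth Ck_on_matrix_mult
        Ck_on_matrix_inv Ck_on_frame_fst[OF J] Ck_on_frame_fst[OF DJ] y open_frame_bundle
        invertible_jacobian_diffeo assms) (auto simp: frame_bundle_def)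
qed

lemma Ck_on_prolong:
  fixes \<phi> :: "real^'n::finite \<Rightarrow> real^'n"
  assumes "smooth_on UNIV \<phi>"
  shows "Ck_on m frame_bundle (prolong \<phi>)"
proof -
  have J: "Ck_on m UNIV (\<lambda>x. jacobian \<phi> (at x))"
    using assms by (intro Ck_on_jacobian open_UNIV) (simp add: smooth_on_def del: Ck_on.simps)
  have P: "Ck_on m UNIV \<phi>" using assms by (simp add: smooth_on_def)
  show ?thesis
    unfolding prolong_def case_prod_beta
    by (intro Ck_on_Pair Ck_on_matrix_mult Ck_on_frame_fst[OF J] Ck_on_frame_fst[OF P]
        open_frame_bundle Ck_on_linear bounded_linear_snd)
qed

lemma prolong_frame_bundle:
  fixes \<phi> :: "real^'n::finite \<Rightarrow> real^'n"
  assumes "bij \<phi>" "smooth_on UNIV \<phi>" "smooth_on UNIV (inv \<phi>)"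
  shows "prolong \<phi> p \<in> frame_bundle \<longleftrightarrow> p \<in> frame_bundle"
  using invertible_jacobian_diffeo[OF assms, of "fst p"]
  by (cases p) (auto simp: prolong_def frame_bundle_def invertible_det_nz det_mul)

lemma prolong_inv:
  fixes \<phi> :: "real^'n::finite \<Rightarrow> real^'n"
  assumes "bij \<phi>" "smooth_on UNIV \<phi>" "smooth_on UNIV (inv \<phi>)"
  shows "prolong (inv \<phi>) (prolong \<phi> p) = p"
  using jacobian_diffeo_inv[OF assms, of "fst p"] assms(1)
  by (cases p) (simp add: prolong_def matrix_mul_assoc bij_def inv_f_f)

lemma compact_smooth_pullback:
  fixes \<phi> :: "real^'n::finite \<Rightarrow> real^'n"
  assumes "bij \<phi>" "smooth_on UNIV \<phi>" "smooth_on UNIV (inv \<phi>)" "compact_smooth g"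
  shows "compact_smooth (\<lambda>p. g (prolong \<phi> p))"
proof -
  obtain K where K: "compact K" "K \<subseteq> frame_bundle" "\<forall>p. p \<notin> K \<longrightarrow> g p = 0"
    using assms(4) unfolding compact_smooth_def by auto
  have i: "bij (inv \<phi>)" "smooth_on UNIV (inv (inv \<phi>))"
    using assms by (simp_all add: bij_imp_bij_inv inv_inv_eq)
  let ?L = "prolong (inv \<phi>) ` K"
  have "continuous_on frame_bundle (prolong (inv \<phi>))"
    using Ck_on_prolong[OF assms(3), of 0] by simp
  then have "compact ?L" using K continuous_on_subset by (blast intro: compact_continuous_image)
  moreover have "?L \<subseteq> frame_bundle"
    using K(2) prolong_frame_bundle[OF i(1) assms(3) i(2)] by blast
  moreover have "g (prolong \<phi> p) = 0" if "p \<notin> ?L" for p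
    using that K(3) prolong_inv[OF assms(1-3)] by (metis imageI)
  moreover have "Ck_on m frame_bundle (\<lambda>p. g (prolong \<phi> p))" for m
    using assms(4) prolong_frame_bundle[OF assms(1-3)] unfolding compact_smooth_def smooth_on_def
    by (intro Ck_on_compose[OF open_frame_bundle Ck_on_prolong[OF assms(2)], of m frame_bundle]) auto
  ultimately show ?thesis unfolding compact_smooth_def smooth_on_def by blast
qed

lift_definition frame_pullback :: "'n::finite diffeo \<Rightarrow> 'n frame_fun \<Rightarrow> 'n frame_fun"
  is "\<lambda>\<phi> g p. g (prolong \<phi> p)"
  by (rule compact_smooth_pullback) auto

lift_definition frame_delta :: "'n \<Rightarrow> 'n \<Rightarrow> 'n \<Rightarrow> 'n::finite diffeo \<Rightarrow> 'n frame_fun \<Rightarrow> 'n frame_fun"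
  is "\<lambda>i j k \<phi> g p. gamma i j k \<phi> p *\<^sub>R g p"
  by (rule compact_smooth_scaleR[OF smooth_gamma]) auto


section \<open>The crossed product and the Connes--Moscovici Hopf algebra\<close>

text \<open>\<open>single \<phi> g\<close> stands for \<open>g U\<^sup>*\<^bsub>\<phi>\<^esub>\<close>. The product is
  \<open>g U\<^sup>*\<^bsub>\<phi>\<^esub> \<cdot> h U\<^sup>*\<^bsub>\<psi>\<^esub> = g (h \<circ> prolong \<phi>) U\<^sup>*\<^bsub>\<psi> \<circ> \<phi>\<^esub>\<close>.\<close>

type_synonym 'n crossed = "'n diffeo \<Rightarrow>\<^sub>0 'n frame_fun"

definition crossed_mult :: "'n::finite crossed \<Rightarrow> 'n crossed \<Rightarrow> 'n crossed" where
  "crossed_mult a b = (\<Sum>\<phi>\<in>Poly_Mapping.keys a. \<Sum>\<psi>\<in>Poly_Mapping.keys b.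
     Poly_Mapping.single (diffeo_comp \<psi> \<phi>)
       (frame_mult (Poly_Mapping.lookup a \<phi>) (frame_pullback \<phi> (Poly_Mapping.lookup b \<psi>))))"

definition crossed_op ::
  "('n diffeo \<Rightarrow> 'n frame_fun \<Rightarrow> 'n frame_fun) \<Rightarrow> 'n::finite crossed \<Rightarrow> 'n crossed" where
  "crossed_op F a = (\<Sum>\<phi>\<in>Poly_Mapping.keys a. Poly_Mapping.single \<phi> (F \<phi> (Poly_Mapping.lookup a \<phi>)))"

definition op_X :: "'n \<Rightarrow> 'n::finite crossed \<Rightarrow> 'n crossed" where
  "op_X k = crossed_op (\<lambda>\<phi>. frame_X k)"

definition op_Y :: "'n \<Rightarrow> 'n \<Rightarrow> 'n::finite crossed \<Rightarrow> 'n crossed" where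
  "op_Y i j = crossed_op (\<lambda>\<phi>. frame_Y i j)"

definition op_delta :: "'n \<Rightarrow> 'n \<Rightarrow> 'n \<Rightarrow> 'n::finite crossed \<Rightarrow> 'n crossed" where
  "op_delta i j k = crossed_op (frame_delta i j k)"

inductive_set cm_ops :: "('n::finite crossed \<Rightarrow> 'n crossed) set" where
  cm_X: "op_X k \<in> cm_ops"
| cm_Y: "op_Y i j \<in> cm_ops"
| cm_delta: "op_delta i j k \<in> cm_ops"
| cm_one: "(\<lambda>a. a) \<in> cm_ops"
| cm_add: "S \<in> cm_ops \<Longrightarrow> T \<in> cm_ops \<Longrightarrow> (\<lambda>a. S a + T a) \<in> cm_ops"
| cm_scale: "S \<in> cm_ops \<Longrightarrow> (\<lambda>a. c *\<^sub>C S a) \<in> cm_ops"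
| cm_mult: "S \<in> cm_ops \<Longrightarrow> T \<in> cm_ops \<Longrightarrow> (\<lambda>a. S (T a)) \<in> cm_ops"

lemma lookup_crossed_op:
  assumes "clinear (F \<phi>)"
  shows "Poly_Mapping.lookup (crossed_op F a) \<phi> = F \<phi> (Poly_Mapping.lookup a \<phi>)"
proof -
  have "F \<phi> 0 = 0" using clinear_diff[OF assms, of 0 0] by simp
  then show ?thesis
    by (simp add: crossed_op_def lookup_sum lookup_single when_def in_keys_iff)
qed

lemma clinear_crossed_op:
  assumes "\<And>\<phi>. clinear (F \<phi>)"
  shows "clinear (crossed_op F)"
  using assms
  by (intro clinearI poly_mapping_eqI)
    (simp_all add: lookup_crossed_op lookup_add lookup_scaleC Vector_Spaces.linear_iff)

lemma clinear_frame_X: "clinear (frame_X k)"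
  by (intro clinearI; transfer) (simp_all add: fun_eq_iff vector_field_X_add vector_field_X_cmult)

lemma clinear_frame_Y: "clinear (frame_Y i j)"
  by (intro clinearI; transfer) (simp_all add: fun_eq_iff vector_field_Y_add vector_field_Y_cmult)

lemma clinear_frame_delta: "clinear (frame_delta i j k \<phi>)"
  by (intro clinearI; transfer) (simp_all add: fun_eq_iff algebra_simps)

lemma clinear_cm_ops: "T \<in> cm_ops \<Longrightarrow> clinear T"
proof (induction rule: cm_ops.induct)
  case (cm_X k)
  show ?case unfolding op_X_def by (intro clinear_crossed_op clinear_frame_X)
next
  case (cm_Y i j)
  show ?case unfolding op_Y_def by (intro clinear_crossed_op clinear_frame_Y)
next
  case (cm_delta i j k)
  show ?case unfolding op_delta_def by (intro clinear_crossed_op clinear_frame_delta)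
next
  case cm_one
  show ?case by (rule clinearI) simp_all
next
  case (cm_add S T)
  then show ?case
    by (intro clinearI) (simp_all add: Vector_Spaces.linear_iff scaleC_add_right)
next
  case (cm_scale S c)
  then show ?case
    by (intro clinearI) (simp_all add: Vector_Spaces.linear_iff scaleC_add_right scaleC_scaleC mult.commute)
next
  case (cm_mult S T)
  then show ?case by (intro clinearI) (simp_all add: Vector_Spaces.linear_iff)
qed

typedef ('n::finite) cm_hopf = "cm_ops :: ('n crossed \<Rightarrow> 'n crossed) set"
  morphisms cm_apply Cm_Hopf
  using cm_one by blast

setup_lifting type_definition_cm_hopf

instantiation cm_hopf :: (finite) complex_algebra_1
begin
lift_definition scaleC_cm_hopf :: "complex \<Rightarrow> 'a cm_hopf \<Rightarrow> 'a cm_hopf" is "\<lambda>c S a. c *\<^sub>C S a"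
  by (rule cm_scale)
lift_definition plus_cm_hopf :: "'a cm_hopf \<Rightarrow> 'a cm_hopf \<Rightarrow> 'a cm_hopf" is "\<lambda>S T a. S a + T a"
  by (rule cm_add)
lift_definition one_cm_hopf :: "'a cm_hopf" is "\<lambda>a. a"
  by (rule cm_one)
lift_definition times_cm_hopf :: "'a cm_hopf \<Rightarrow> 'a cm_hopf \<Rightarrow> 'a cm_hopf" is "\<lambda>S T a. S (T a)"
  by (rule cm_mult)
definition zero_cm_hopf :: "'a cm_hopf" where "zero_cm_hopf = 0 *\<^sub>C 1"
definition uminus_cm_hopf :: "'a cm_hopf \<Rightarrow> 'a cm_hopf" where "uminus_cm_hopf f = (- 1) *\<^sub>C f"
definition minus_cm_hopf :: "'a cm_hopf \<Rightarrow> 'a cm_hopf \<Rightarrow> 'a cm_hopf" where "minus_cm_hopf f g = f + - g"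
instance
proof
  fix a b c :: "'a cm_hopf" and z w :: complex
  have lin: "T (x + y) = T x + T y" "T (z *\<^sub>C x) = z *\<^sub>C T x"
    if "T \<in> cm_ops" for T :: "'a crossed \<Rightarrow> 'a crossed" and x y z
    using clinear_cm_ops[OF that] by (simp_all add: Vector_Spaces.linear_iff)
  show "a + b + c = a + (b + c)" by transfer (simp add: add.assoc)
  show "a + b = b + a" by transfer (simp add: add.commute)
  have neg: "(- 1) *\<^sub>C x + x = 0" for x :: "'a crossed"
    using scaleC_add_left[of "- 1" 1 x] by (simp add: scaleC_one)
  show "0 + a = a" unfolding zero_cm_hopf_def by transfer simp
  show "- a + a = 0" unfolding zero_cm_hopf_def uminus_cm_hopf_def
    by transfer (simp only: fun_eq_iff neg cvec.scale_zero_left simp_thms)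
  show "a - b = a + - b" by (rule minus_cm_hopf_def)
  show "z *\<^sub>C (a + b) = z *\<^sub>C a + z *\<^sub>C b" by transfer (simp add: scaleC_add_right)
  show "(z + w) *\<^sub>C a = z *\<^sub>C a + w *\<^sub>C a" by transfer (simp add: scaleC_add_left)
  show "z *\<^sub>C w *\<^sub>C a = (z * w) *\<^sub>C a" by transfer (simp add: scaleC_scaleC)
  show "1 *\<^sub>C a = a" by transfer (simp add: scaleC_one)
  show "a * b * c = a * (b * c)" by transfer simp
  show "(a + b) * c = a * c + b * c" by transfer simp
  show "a * (b + c) = a * b + a * c" by transfer (simp add: lin)
  show "1 * a = a" "a * 1 = a" by (transfer, simp)+
  show "(z *\<^sub>C a) * b = z *\<^sub>C (a * b)" by transfer simp
  show "a * (z *\<^sub>C b) = z *\<^sub>C (a * b)" by transfer (simp add: lin)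
qed
end

text \<open>The coproduct \<open>\<Delta> h = h\<^sup>(\<^sup>1\<^sup>) \<otimes> h\<^sup>(\<^sup>2\<^sup>)\<close> is determined by
  \<open>h (a b) = h\<^sup>(\<^sup>1\<^sup>)(a) h\<^sup>(\<^sup>2\<^sup>)(b)\<close>.\<close>

definition cm_coproduct :: "'n::finite cm_hopf \<Rightarrow> ('n cm_hopf, 'n cm_hopf) tensor" where
  "cm_coproduct h = (THE t. \<forall>a b. cm_apply h (crossed_mult a b) =
     tensor_lift (\<lambda>h1 h2. crossed_mult (cm_apply h1 a) (cm_apply h2 b)) t)"

text \<open>The crossed product has no unit, because the constant function \<open>1\<close> is not compactly
  supported. The operators are local, and \<open>h 1 = \<epsilon>(h) 1\<close> is read locally: it holds on every open
  set \<open>V\<close> for every \<open>g U\<^sup>*\<^bsub>id\<^esub>\<close> such that \<open>g = 1\<close> on \<open>V\<close>.\<close>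

definition cm_counit :: "'n::finite cm_hopf \<Rightarrow> complex" where
  "cm_counit h = (THE c. \<forall>g V. open V \<and> V \<subseteq> frame_bundle \<and> (\<forall>p\<in>V. frame_eval g p = 1) \<longrightarrow>
     (\<forall>\<phi>. \<forall>p\<in>V. frame_eval (Poly_Mapping.lookup (cm_apply h (Poly_Mapping.single diffeo_id g)) \<phi>) p =
       c * frame_eval (Poly_Mapping.lookup (Poly_Mapping.single diffeo_id g) \<phi>) p))"

end

theory Submission
  imports Defs "HOL-Computational_Algebra.Polynomial"
begin

text \<open>The element \<open>y = Y\<^sub>i\<^sup>i\<close> of \<open>\<H>\<^sub>n\<close> is primitive, \<open>\<Delta> y = y \<otimes> 1 + 1 \<otimes> y\<close>, and its powers are
  linearly independent. A total integral \<open>f\<close> therefore satisfies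
  \<open>\<rho> (f y) = f y \<otimes> 1 + 1 \<otimes> y\<close>. In a finite-dimensional algebra \<open>A\<close> some power of \<open>f y\<close> is a
  combination of lower ones. The algebra map \<open>\<rho>\<close> transports this relation to \<open>A \<otimes> \<H>\<^sub>n\<close>, and
  comparing the coefficients of the highest power of \<open>y\<close> gives \<open>1 = 0\<close> in \<open>A\<close>
  (\<open>total_integral_primitive_zero_algebra\<close>). So \<open>A = 0\<close>, and the zero algebra has only the trivial
  coaction.

  Two facts about \<open>\<H>\<^sub>n\<close> are used. The first is the value of the coproduct at \<open>y\<close>. That \<open>y\<close> acts by
  a derivation of the crossed product holds because \<open>Y\<^sub>i\<^sup>j\<close> commutes with the prolongations of all
  diffeomorphisms. Since \<open>\<Delta> y\<close> is only determined by its action on products, one also needs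
  that \<open>\<H>\<^sub>n \<otimes> \<H>\<^sub>n\<close> acts faithfully on pairs of elements of the crossed product
  (\<open>cm_tensor_action_faithful\<close>). Instead of a Poincare--Birkhoff--Witt basis, the argument uses
  symmetry: all operators in \<open>\<H>\<^sub>n\<close> commute with translations by affine maps, which act transitively on
  the frame bundle, so an element of \<open>\<H>\<^sub>n\<close> whose values all vanish at one point is \<open>0\<close>
  (\<open>cm_hopf_eq_0_at_point\<close>).

  The second is the linear independence of the powers of \<open>y\<close> (\<open>cm_Y_not_algebraic\<close>). It is seen
  on compactly supported functions that vanish to prescribed order at the point \<open>(0, 1)\<close> of the
  frame bundle, since each application of \<open>y\<close> lowers the order by one.\<close>

section \<open>Linear maps and tensor products\<close>

lemma clinear_add: "clinear f \<Longrightarrow> f (x + y) = f x + f y"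
  and clinear_scaleC: "clinear f \<Longrightarrow> f (c *\<^sub>C x) = c *\<^sub>C f x"
  by (simp_all add: Vector_Spaces.linear_iff)

lemma clinear_zero: "clinear f \<Longrightarrow> f 0 = 0"
  using clinear_diff[of f 0 0] by simp

lemma clinear_comp: "clinear f \<Longrightarrow> clinear g \<Longrightarrow> clinear (\<lambda>x. g (f x))"
  by (rule clinearI) (simp_all add: clinear_add clinear_scaleC)

lemma clinear_span_eq_0:
  assumes "clinear f" "\<And>x. x \<in> S \<Longrightarrow> f x = 0" "x \<in> cspan S"
  shows "f x = 0"
  using assms(3)
  by (induction rule: cvec.span_induct_alt)
    (simp_all add: assms(2) clinear_zero[OF assms(1)] clinear_add[OF assms(1)] clinear_scaleC[OF assms(1)])

lemma clinear_span_in: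
  assumes "clinear f" "\<And>x. x \<in> S \<Longrightarrow> f x \<in> cspan T" "x \<in> cspan S"
  shows "f x \<in> cspan T"
  using assms(3)
  by (induction rule: cvec.span_induct_alt)
    (simp_all add: assms(2) clinear_zero[OF assms(1)] clinear_add[OF assms(1)]
      clinear_scaleC[OF assms(1)] cvec.span_zero cvec.span_add cvec.span_scale)

lemma cbilinearI:
  assumes "\<And>a a' b. f (a + a') b = f a b + f a' b" "\<And>a b b'. f a (b + b') = f a b + f a b'"
    and "\<And>c a b. f (c *\<^sub>C a) b = c *\<^sub>C f a b" "\<And>c a b. f a (c *\<^sub>C b) = c *\<^sub>C f a b"
  shows "cbilinear f"
  unfolding cbilinear_def using assms by (auto intro!: clinearI)

lemma tensor_zero_left: "0 \<otimes> b = 0" and tensor_zero_right: "a \<otimes> 0 = 0"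
  using tensor_scaleC_left[of 0 0 b] tensor_scaleC_right[of a 0 0] by simp_all

text \<open>The slice maps \<open>\<mu> \<otimes> id\<close> and \<open>id \<otimes> \<mu>\<close>, identified with maps into a single tensor factor.\<close>

definition slice_left :: "('a::complex_vector \<Rightarrow> complex) \<Rightarrow> ('a, 'b::complex_vector) tensor \<Rightarrow> 'b" where
  "slice_left \<mu> = tensor_lift (\<lambda>a b. \<mu> a *\<^sub>C b)"

definition slice_right :: "('b::complex_vector \<Rightarrow> complex) \<Rightarrow> ('a::complex_vector, 'b) tensor \<Rightarrow> 'a" where
  "slice_right \<mu> = tensor_lift (\<lambda>a b. \<mu> b *\<^sub>C a)"

lemma cbilinear_slice:
  assumes "clinear \<mu>"
  shows "cbilinear (\<lambda>a b. \<mu> a *\<^sub>C b)" "cbilinear (\<lambda>a b. \<mu> b *\<^sub>C a)"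
  by (intro cbilinearI; simp add: clinear_add[OF assms] clinear_scaleC[OF assms] scaleC_add_left
      scaleC_add_right scaleC_scaleC scaleC_complex_def mult.commute)+

lemma clinear_slice:
  assumes "clinear \<mu>"
  shows "clinear (slice_left \<mu>)" "clinear (slice_right \<mu>)"
  unfolding slice_left_def slice_right_def
  by (intro clinear_tensor_lift cbilinear_slice assms)+

lemma slice_tensor:
  assumes "clinear \<mu>"
  shows "slice_left \<mu> (a \<otimes> b) = \<mu> a *\<^sub>C b" "slice_right \<mu> (c \<otimes> d) = \<mu> d *\<^sub>C c"
  unfolding slice_left_def slice_right_def
  by (intro tensor_lift_tensor cbilinear_slice assms)+

lemma slice_commute:
  assumes "clinear \<mu>" "clinear \<nu>"
  shows "\<mu> (slice_right \<nu> t) = \<nu> (slice_left \<mu> t)"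
proof (induction t rule: tensor_induct)
  case zero
  show ?case using assms by (simp add: clinear_zero clinear_slice)
next
  case (tensor a b)
  show ?case
    by (simp add: slice_tensor assms clinear_scaleC[OF assms(1)] clinear_scaleC[OF assms(2)]
      scaleC_complex_def mult.commute)
next
  case (add x y)
  then show ?case using assms by (simp add: clinear_add clinear_slice)
qed

lemma tensor_basis_expansion:
  fixes t :: "('a::complex_vector, 'b::complex_vector) tensor"
  assumes "cspan B = UNIV"
  obtains F h where "finite F" "F \<subseteq> B" "t = (\<Sum>b\<in>F. h b \<otimes> b)"
proof -
  have "\<exists>F h. finite F \<and> F \<subseteq> B \<and> t = (\<Sum>b\<in>F. h b \<otimes> b)"
  proof (induction t rule: tensor_induct)
    case zero
    show ?case by (intro exI[of _ "{}"]) simp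
  next
    case (tensor a b)
    have "b \<in> cspan B" using assms by simp
    then obtain F r where F: "finite F" "F \<subseteq> B" and b: "(\<Sum>v\<in>F. r v *\<^sub>C v) = b"
      unfolding cvec.span_explicit by auto
    have "a \<otimes> (\<Sum>v\<in>F. r v *\<^sub>C v) = (\<Sum>v\<in>F. (r v *\<^sub>C a) \<otimes> v)"
      using F(1) by (induction F rule: finite_induct)
        (simp_all add: tensor_zero_right tensor_add_right tensor_scaleC_left tensor_scaleC_right)
    then show ?case
      using F b by (intro exI[of _ F] exI[of _ "\<lambda>v. r v *\<^sub>C a"]) simp
  next
    case (add x y)
    then obtain F G h k where *: "finite F" "F \<subseteq> B" "x = (\<Sum>b\<in>F. h b \<otimes> b)"
      "finite G" "G \<subseteq> B" "y = (\<Sum>b\<in>G. k b \<otimes> b)" by blast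
    have "x = (\<Sum>b\<in>F \<union> G. (if b \<in> F then h b else 0) \<otimes> b)"
      unfolding *(3) by (rule sum.mono_neutral_cong_left) (use *(1,4) in \<open>auto simp: tensor_zero_left\<close>)
    moreover have "y = (\<Sum>b\<in>F \<union> G. (if b \<in> G then k b else 0) \<otimes> b)"
      unfolding *(6) by (rule sum.mono_neutral_cong_left) (use *(1,4) in \<open>auto simp: tensor_zero_left\<close>)
    ultimately have "x + y = (\<Sum>b\<in>F \<union> G.
        ((if b \<in> F then h b else 0) + (if b \<in> G then k b else 0)) \<otimes> b)"
      by (simp add: sum.distrib tensor_add_left)
    then show ?case using *(1,2,4,5)
      by (intro exI[of _ "F \<union> G"] exI[of _ "\<lambda>b. (if b \<in> F then h b else 0) + (if b \<in> G then k b else 0)"]) simp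
  qed
  then show ?thesis using that by blast
qed

lemma clinear_sum: "clinear f \<Longrightarrow> f (\<Sum>i\<in>I. g i) = (\<Sum>i\<in>I. f (g i))"
  by (induction I rule: infinite_finite_induct) (simp_all add: clinear_zero clinear_add)

text \<open>Write \<open>t = \<Sum> h\<^sub>b \<otimes> b\<close> over finitely many elements of a basis of the right factor. Slicing
  with the coordinate functionals of the basis recovers the coefficients \<open>h\<^sub>b\<close>.\<close>

lemma tensor_eq_0_if_slice_right:
  fixes t :: "('a::complex_vector, 'b::complex_vector) tensor"
  assumes "\<And>\<mu>. clinear \<mu> \<Longrightarrow> slice_right \<mu> t = 0"
  shows "t = 0"
proof -
  obtain B :: "'b set" where B: "cvec.independent B" "cspan B = UNIV"
    using cvec.basis_exists[of UNIV] by (metis top.extremum_uniqueI)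
  then obtain F h where F: "finite F" "F \<subseteq> B" "t = (\<Sum>b\<in>F. h b \<otimes> b)"
    using tensor_basis_expansion[of B t] by blast
  have "h b = 0" if "b \<in> F" for b
  proof -
    let ?\<mu> = "\<lambda>x. cvec.representation B x b"
    have \<mu>: "clinear ?\<mu>"
      using B by (intro clinearI)
        (auto simp: cvec.representation_add[OF B(1)] cvec.representation_scale[OF B(1)] scaleC_complex_def)
    have \<delta>: "?\<mu> b' = (if b' = b then 1 else 0)" if "b' \<in> F" for b'
      using cvec.representation_basis[OF B(1)] F(2) that by auto
    have "0 = slice_right ?\<mu> t" using assms[OF \<mu>] by simp
    also have "\<dots> = (\<Sum>b'\<in>F. ?\<mu> b' *\<^sub>C h b')"
      unfolding F(3) by (simp add: clinear_sum[OF clinear_slice(2)[OF \<mu>]] slice_tensor(2)[OF \<mu>])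
    also have "\<dots> = (\<Sum>b'\<in>F. if b' = b then h b' else 0)"
      by (intro sum.cong) (auto simp: \<delta> scaleC_one)
    also have "\<dots> = h b" using F(1) that by simp
    finally show ?thesis by simp
  qed
  then show ?thesis unfolding F(3) by (simp add: tensor_zero_left)
qed

text \<open>A functional on each factor may be applied in either order. So the vanishing of the slices by a
  separating family on the left forces every slice by a functional on the right to vanish.\<close>

lemma tensor_eq_0_if_separating_slices:
  assumes "\<And>\<phi>. \<phi> \<in> \<Phi> \<Longrightarrow> clinear \<phi>"
    and sep: "\<And>x. (\<And>\<phi>. \<phi> \<in> \<Phi> \<Longrightarrow> \<phi> x = 0) \<Longrightarrow> x = 0"
    and "\<And>\<phi>. \<phi> \<in> \<Phi> \<Longrightarrow> slice_left \<phi> t = 0"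
  shows "t = 0"
proof (rule tensor_eq_0_if_slice_right)
  fix \<mu> :: "'b \<Rightarrow> complex" assume "clinear \<mu>"
  then show "slice_right \<mu> t = 0"
    using assms(1,3) by (intro sep) (simp add: slice_commute clinear_zero)
qed


section \<open>Total integrals and primitive elements\<close>

lemma finite_dimensional_power_in_span:
  fixes a :: "'a::complex_algebra_1"
  assumes "finite_dimensional TYPE('a)"
  shows "\<exists>N. a ^ N \<in> cspan ((\<lambda>k. a ^ k) ` {..<N})"
proof (rule ccontr)
  assume *: "\<nexists>N. a ^ N \<in> cspan ((\<lambda>k. a ^ k) ` {..<N})"
  obtain B :: "'a set" where B: "finite B" "cspan B = UNIV"
    using assms unfolding finite_dimensional_def by blast
  have "cvec.independent ((\<lambda>k. a ^ k) ` {..<N}) \<and> card ((\<lambda>k. a ^ k) ` {..<N}) = N" for N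
  proof (induction N)
    case 0
    show ?case by (simp add: cvec.independent_empty)
  next
    case (Suc N)
    have "a ^ N \<notin> cspan ((\<lambda>k. a ^ k) ` {..<N})" using * by blast
    moreover from this have "a ^ N \<notin> (\<lambda>k. a ^ k) ` {..<N}" using cvec.span_base[of "a ^ N"] by metis
    ultimately show ?case
      using Suc by (simp add: lessThan_Suc cvec.independent_insert)
  qed
  then show False
    using cvec.independent_span_bound[OF B(1), of "(\<lambda>k. a ^ k) ` {..<Suc (card B)}"] B(2) by simp
qed

lemma algebra_map_power:
  assumes "algebra_map f"
  shows "f (x ^ n) = f x ^ n"
  using assms by (induction n) (simp_all add: algebra_map_def)

text \<open>The binomial expansion with only its leading term in \<open>y\<close> kept.\<close>

lemma power_tensor_sum_mod_lower:
  fixes a :: "'a::complex_algebra_1" and y :: "'h::complex_algebra_1"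
  shows "(a \<otimes> 1 + 1 \<otimes> y) ^ m - 1 \<otimes> y ^ m \<in> cspan {x \<otimes> y ^ k | x k. k < m}"
proof (induction m)
  case 0
  show ?case by (simp add: one_tensor_def cvec.span_zero)
next
  case (Suc m)
  let ?z = "a \<otimes> 1 + 1 \<otimes> y" and ?S = "\<lambda>m. {(x :: 'a) \<otimes> y ^ k | x k. k < m}"
  have "(?z ^ m - 1 \<otimes> y ^ m) * ?z \<in> cspan (?S (Suc m))"
  proof (rule clinear_span_in[OF clinear_times_tensor_left _ Suc.IH])
    fix s assume "s \<in> ?S m"
    then obtain x k where s: "s = x \<otimes> y ^ k" "k < m" by blast
    have "s * ?z = (x * a) \<otimes> y ^ k + x \<otimes> y ^ Suc k"
      by (simp add: s distrib_left times_tensor_tensor power_Suc2 del: power_Suc)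
    moreover have "(x * a) \<otimes> y ^ k \<in> ?S (Suc m)" "x \<otimes> y ^ Suc k \<in> ?S (Suc m)"
      using s(2) less_SucI[OF s(2)] Suc_less_eq[of k m] by blast+
    ultimately show "s * ?z \<in> cspan (?S (Suc m))"
      by (simp only: cvec.span_add cvec.span_base)
  qed
  moreover have "a \<otimes> y ^ m \<in> cspan (?S (Suc m))"
    by (auto intro!: cvec.span_base)
  ultimately have "(?z ^ m - 1 \<otimes> y ^ m) * ?z + a \<otimes> y ^ m \<in> cspan (?S (Suc m))"
    by (rule cvec.span_add)
  moreover have "(?z ^ m - 1 \<otimes> y ^ m) * ?z + a \<otimes> y ^ m = ?z ^ Suc m - 1 \<otimes> y ^ Suc m"
    by (simp add: left_diff_distrib distrib_left times_tensor_tensor power_Suc2 del: power_Suc)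
  ultimately show ?case by simp
qed

text \<open>Some power \<open>(f y)\<^sup>N\<close> is a combination of the lower ones, and \<open>\<rho>\<close> carries this relation to
  \<open>A \<otimes> H\<close>, where \<open>\<rho> (f y) = f y \<otimes> 1 + 1 \<otimes> y\<close>. Only \<open>(f y \<otimes> 1 + 1 \<otimes> y)\<^sup>N\<close> contributes a term
  \<open>1 \<otimes> y\<^sup>N\<close>, so a functional \<open>\<mu>\<close> that detects \<open>y\<^sup>N\<close> and kills the lower powers of \<open>y\<close> turns the
  relation into \<open>\<mu> (y\<^sup>N) 1 = 0\<close> in \<open>A\<close>.\<close>

lemma total_integral_primitive_zero_algebra:
  fixes \<rho> :: "'a::complex_algebra_1 \<Rightarrow> ('a, 'h::complex_algebra_1) tensor"
  assumes fd: "finite_dimensional TYPE('a)"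
    and \<rho>: "algebra_map \<rho>"
    and f: "total_integral \<Delta> \<rho> f"
    and y: "\<Delta> y = y \<otimes> 1 + 1 \<otimes> y"
    and nonalgebraic: "\<And>N. \<exists>\<mu> :: 'h \<Rightarrow> complex. clinear \<mu> \<and> (\<forall>k<N. \<mu> (y ^ k) = 0) \<and> \<mu> (y ^ N) \<noteq> 0"
  shows "(1 :: 'a) = 0"
proof -
  obtain N where N: "f y ^ N \<in> cspan ((\<lambda>k. f y ^ k) ` {..<N})"
    using finite_dimensional_power_in_span[OF fd] by blast
  obtain \<mu> :: "'h \<Rightarrow> complex"
    where \<mu>: "clinear \<mu>" "\<And>k. k < N \<Longrightarrow> \<mu> (y ^ k) = 0" "\<mu> (y ^ N) \<noteq> 0"
    using nonalgebraic[of N] by blast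
  have fl: "clinear f" "f 1 = 1" using f by (simp_all add: total_integral_def)
  have bil: "cbilinear (\<lambda>a b :: 'h. f a \<otimes> b)"
    by (rule cbilinearI) (simp_all add: clinear_add[OF fl(1)] clinear_scaleC[OF fl(1)]
      tensor_add_left tensor_add_right tensor_scaleC_left tensor_scaleC_right)
  have "\<rho> (f y) = tensor_map f id (\<Delta> y)"
    using f by (simp add: total_integral_def)
  also have "\<dots> = f y \<otimes> 1 + 1 \<otimes> y"
    unfolding y tensor_map_def id_apply
    by (simp add: clinear_add[OF clinear_tensor_lift[OF bil]] tensor_lift_tensor[OF bil] fl(2))
  finally have \<rho>y: "\<rho> (f y) = f y \<otimes> 1 + 1 \<otimes> y" .
  have slice: "slice_right \<mu> (\<rho> (f y ^ k)) = \<mu> (y ^ k) *\<^sub>C 1" if "k \<le> N" for k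
  proof -
    have "slice_right \<mu> (\<rho> (f y ^ k) - 1 \<otimes> y ^ k) = 0"
      unfolding algebra_map_power[OF \<rho>] \<rho>y using that
      by (intro clinear_span_eq_0[OF clinear_slice(2)[OF \<mu>(1)] _ power_tensor_sum_mod_lower])
        (auto simp: slice_tensor(2)[OF \<mu>(1)] \<mu>(2))
    then show ?thesis
      by (simp add: clinear_diff[OF clinear_slice(2)[OF \<mu>(1)]] slice_tensor(2)[OF \<mu>(1)])
  qed
  have "slice_right \<mu> (\<rho> (f y ^ N)) = 0"
  proof (rule clinear_span_eq_0[OF _ _ N])
    show "clinear (\<lambda>x. slice_right \<mu> (\<rho> x))"
      using \<rho> by (intro clinear_comp[OF _ clinear_slice(2)[OF \<mu>(1)]]) (simp add: algebra_map_def)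
  qed (auto simp: slice \<mu>(2))
  then have "\<mu> (y ^ N) *\<^sub>C (1 :: 'a) = 0" using slice by simp
  then show ?thesis using \<mu>(3) by simp
qed


section \<open>Bump functions\<close>

text \<open>The polynomial factor makes this family of functions, which are all flat at \<open>0\<close>, closed under
  differentiation.\<close>

definition exp_flat :: "real poly \<Rightarrow> real \<Rightarrow> real" where
  "exp_flat P t = (if t > 0 then poly P (1 / t) * exp (- (1 / t)) else 0)"

lemma poly_times_exp_minus_tendsto_0:
  "((\<lambda>x :: real. poly P x * exp (- x)) \<longlongrightarrow> 0) at_top"
proof -
  have "((\<lambda>x :: real. \<Sum>i\<le>degree P. coeff P i * (x ^ i / exp x)) \<longlongrightarrow> (\<Sum>i\<le>degree P. coeff P i * 0)) at_top"
    by (intro tendsto_intros tendsto_power_div_exp_0)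
  then show ?thesis
    by (simp add: poly_altdef sum_distrib_right exp_minus divide_inverse mult.assoc)
qed

lemma exp_flat_has_derivative:
  "(exp_flat P has_real_derivative exp_flat ([:0, 0, 1:] * (P - pderiv P)) t) (at t)"
proof (cases t "0 :: real" rule: linorder_cases)
  case less
  have "((\<lambda>_. 0) has_real_derivative 0) (at t)" by simp
  then have "(exp_flat P has_real_derivative 0) (at t)"
    by (rule has_field_derivative_transform_within_open[where S = "{..<0}"])
      (use less in \<open>auto simp: exp_flat_def\<close>)
  then show ?thesis using less by (simp add: exp_flat_def)
next
  case greater
  have "((\<lambda>t. poly P (1 / t) * exp (- (1 / t))) has_real_derivative
      poly ([:0, 0, 1:] * (P - pderiv P)) (1 / t) * exp (- (1 / t))) (at t)"
    using greater
    by (auto intro!: derivative_eq_intros DERIV_chain2[OF poly_DERIV] simp: field_simps power2_eq_square)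
  then have "(exp_flat P has_real_derivative
      poly ([:0, 0, 1:] * (P - pderiv P)) (1 / t) * exp (- (1 / t))) (at t)"
    by (rule has_field_derivative_transform_within_open[where S = "{0<..}"])
      (use greater in \<open>auto simp: exp_flat_def\<close>)
  then show ?thesis using greater by (simp add: exp_flat_def)
next
  case equal
  \<comment> \<open>\<open>pCons 0 P\<close> absorbs the factor \<open>1 / h\<close> of the difference quotient.\<close>
  have "((\<lambda>h. poly (pCons 0 P) (inverse h) * exp (- inverse h)) \<longlongrightarrow> 0) (at_right (0 :: real))"
    using filterlim_compose[OF poly_times_exp_minus_tendsto_0 filterlim_inverse_at_top_right] .
  then have "((\<lambda>h. exp_flat P h / h) \<longlongrightarrow> 0) (at_right 0)"
    by (rule filterlim_cong[OF refl refl, THEN iffD1, rotated])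
      (auto simp: eventually_at_right_field exp_flat_def field_simps intro: exI[of _ 1])
  moreover have "((\<lambda>h. exp_flat P h / h) \<longlongrightarrow> 0) (at_left 0)"
    by (rule tendsto_eventually) (auto simp: eventually_at_left_field exp_flat_def intro: exI[of _ "-1"])
  ultimately have "((\<lambda>h. exp_flat P h / h) \<longlongrightarrow> 0) (at 0)"
    by (simp add: filterlim_at_split)
  then show ?thesis using equal by (simp add: DERIV_def exp_flat_def)
qed

lemma Ck_on_exp_flat: "Ck_on k UNIV (exp_flat P)"
proof (induction k arbitrary: P)
  case 0
  show ?case
    using DERIV_isCont[OF exp_flat_has_derivative] by (simp add: continuous_at_imp_continuous_on)
next
  case (Suc k)
  show ?case
  proof (rule Ck_on_SucI[OF open_UNIV])
    show "(exp_flat P has_derivative (*) (exp_flat ([:0, 0, 1:] * (P - pderiv P)) t)) (at t)" for t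
      using exp_flat_has_derivative unfolding has_field_derivative_def .
  qed (intro Ck_on_bilinear[OF _ bounded_bilinear_mult] Suc.IH Ck_on_const open_UNIV)
qed

text \<open>The witness is \<open>q \<mapsto> exp (- 1 / (r\<^sup>2 - |q - p|\<^sup>2))\<close>, extended by \<open>0\<close> outside the ball of radius \<open>r\<close>
  around \<open>p\<close>.\<close>

lemma exists_bump:
  fixes p :: "'a::euclidean_space"
  assumes "open S" "p \<in> S"
  obtains b :: "'a \<Rightarrow> real" and K
  where "smooth_on S b" "compact K" "K \<subseteq> S" "\<And>q. q \<notin> K \<Longrightarrow> b q = 0" "b p \<noteq> 0"
proof -
  obtain r where r: "r > 0" "cball p r \<subseteq> S" using assms open_contains_cball by blast
  \<comment> \<open>Written with sums and products only, so that the closure rules for \<open>Ck_on\<close> apply.\<close>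
  define b where "b q = exp_flat 1 (r\<^sup>2 + (- 1) * ((q + (- p)) \<bullet> (q + (- p))))" for q
  have "Ck_on k S b" for k
    unfolding b_def using assms(1)
    by (intro Ck_on_compose[OF _ _ Ck_on_exp_flat] Ck_on_add Ck_on_const
        Ck_on_bilinear[OF _ bounded_bilinear_mult] Ck_on_bilinear[OF _ bounded_bilinear_inner]
        Ck_on_linear bounded_linear_ident) simp_all
  moreover have "b q = 0" if "q \<notin> cball p r" for q
  proof -
    have "r\<^sup>2 \<le> (norm (q - p))\<^sup>2"
      using that r(1) by (intro power_mono) (auto simp: dist_norm norm_minus_commute)
    then show ?thesis by (simp add: b_def exp_flat_def dot_square_norm)
  qed
  moreover have "b p \<noteq> 0" using r(1) by (simp add: b_def exp_flat_def)
  ultimately show ?thesis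
    using that[of b "cball p r"] r(2) by (simp add: smooth_on_def)
qed


section \<open>Pullbacks of vector fields along prolongations\<close>

lemma bounded_linear_euclidean:
  fixes f :: "'a::euclidean_space \<Rightarrow> 'b::real_normed_vector"
  assumes "\<And>x y. f (x + y) = f x + f y" "\<And>c x. f (c *\<^sub>R x) = c *\<^sub>R f x"
  shows "bounded_linear f"
  using assms by (intro linear_conv_bounded_linear[THEN iffD1] linearI)

lemma matrix_mult_add_right: "A ** (B + C) = A ** B + A ** (C :: real^'n^'m)"
  and matrix_mult_scaleR_right: "A ** (c *\<^sub>R B) = c *\<^sub>R (A ** (B :: real^'n^'m))"
  and matrix_mult_add_left: "(A + D) ** B = A ** B + D ** (B :: real^'n^'m)"
  and matrix_mult_scaleR_left: "(c *\<^sub>R A) ** B = c *\<^sub>R (A ** (B :: real^'n^'m))"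
  by (simp_all add: matrix_matrix_mult_def vec_eq_iff algebra_simps sum.distrib sum_distrib_left)

lemma bounded_linear_matrix_mult_right: "bounded_linear (\<lambda>B :: real^'n^'m. (A :: real^'m^'l) ** B)"
  by (intro bounded_linear_euclidean) (simp_all add: matrix_mult_add_right matrix_mult_scaleR_right)

lemma bounded_linear_matrix_mult_left: "bounded_linear (\<lambda>A :: real^'m^'l. A ** (B :: real^'n^'m))"
  by (intro bounded_linear_euclidean) (simp_all add: matrix_mult_add_left matrix_mult_scaleR_left)

lemma column_expansion: "(\<Sum>\<mu>\<in>UNIV. (y :: real^'n^'m) $ \<mu> $ k *\<^sub>R axis \<mu> 1) = column k y"
  by (simp add: vec_eq_iff column_def axis_def if_distrib[of "(*) _"] cong: if_cong)

lemma column_matrix_mult: "column k (A ** B) = (A :: real^'m^'l) *v column k (B :: real^'n^'m)"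
  by (simp add: vec_eq_iff column_def matrix_matrix_mult_def matrix_vector_mult_def)

text \<open>At \<open>(x, y)\<close> the field \<open>X\<^sub>k\<close> moves \<open>x\<close> in the direction of the \<open>k\<close>-th frame vector, and \<open>Y\<^sub>i\<^sup>j\<close> moves
  \<open>y\<close> in the direction of \<open>y\<close> times a matrix unit. A prolongation acts on \<open>y\<close> from the left, which
  commutes with this right multiplication; this form of the fields makes their invariance visible.\<close>

lemma vector_field_X_eq:
  assumes "compact_smooth g"
  shows "vector_field_X k g p = frechet_derivative g (at p) (column k (snd p), 0)"
proof -
  obtain x y where p: "p = (x, y)" by (cases p)
  interpret bounded_linear "frechet_derivative g (at (x, y))"
    using compact_smooth_has_derivative[OF assms] has_derivative_bounded_linear by blast
  have "(column k y, 0) = (\<Sum>\<mu>\<in>UNIV. y $ \<mu> $ k *\<^sub>R (axis \<mu> 1, 0 :: real^'a^'a))"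
    by (simp add: prod_eq_iff fst_sum snd_sum column_expansion)
  then show ?thesis unfolding vector_field_X_def p prod.case snd_conv by (simp only: sum scaleR)
qed

lemma vector_field_Y_eq:
  assumes "compact_smooth g"
  shows "vector_field_Y i j g p = frechet_derivative g (at p) (0, snd p ** axis i (axis j 1))"
proof -
  obtain x y where p: "p = (x, y)" by (cases p)
  interpret bounded_linear "frechet_derivative g (at (x, y))"
    using compact_smooth_has_derivative[OF assms] has_derivative_bounded_linear by blast
  have "y ** axis i (axis j 1) = (\<Sum>\<mu>\<in>UNIV. y $ \<mu> $ i *\<^sub>R axis \<mu> (axis j 1))"
    by (simp add: vec_eq_iff matrix_matrix_mult_def axis_def if_distrib[of "(*) _"]
        if_distrib[of "\<lambda>x. x $ _"] cong: if_cong)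
  then have "(0, y ** axis i (axis j 1)) = (\<Sum>\<mu>\<in>UNIV. y $ \<mu> $ i *\<^sub>R (0 :: real^'a, axis \<mu> (axis j 1)))"
    by (simp add: prod_eq_iff fst_sum snd_sum)
  then show ?thesis unfolding vector_field_Y_def p prod.case snd_conv by (simp only: sum scaleR)
qed

text \<open>On a fibre, where \<open>x\<close> is constant, a prolongation is the linear map \<open>y \<mapsto> \<phi>' (x) y\<close>. This is why
  \<open>Y\<^sub>i\<^sup>j\<close> commutes with all diffeomorphisms, while \<open>X\<^sub>k\<close> commutes with the affine ones only.\<close>

lemma frechet_derivative_pullback_vertical:
  fixes \<phi> :: "real^'n::finite \<Rightarrow> real^'n"
  assumes "bij \<phi>" "smooth_on UNIV \<phi>" "smooth_on UNIV (inv \<phi>)" "compact_smooth g"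
  shows "frechet_derivative (\<lambda>p. g (prolong \<phi> p)) (at p) (0, w) =
    frechet_derivative g (at (prolong \<phi> p)) (0, jacobian \<phi> (at (fst p)) ** w)"
proof -
  obtain x y where p: "p = (x, y)" by (cases p)
  let ?J = "jacobian \<phi> (at x)"
  have "((\<lambda>y'. (x, y')) has_derivative (\<lambda>w. (0, w))) (at y)"
    by (auto intro!: derivative_eq_intros)
  then have A: "((\<lambda>y'. g (prolong \<phi> (x, y'))) has_derivative
      (\<lambda>w. frechet_derivative (\<lambda>p. g (prolong \<phi> p)) (at (x, y)) (0, w))) (at y)"
    by (rule has_derivative_compose)
      (rule compact_smooth_has_derivative[OF compact_smooth_pullback[OF assms]])
  have "((\<lambda>y'. prolong \<phi> (x, y')) has_derivative (\<lambda>w. (0, ?J ** w))) (at y)"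
    unfolding prolong_def prod.case
    by (intro has_derivative_Pair has_derivative_const
        bounded_linear_imp_has_derivative bounded_linear_matrix_mult_right)
  then have "((\<lambda>y'. g (prolong \<phi> (x, y'))) has_derivative
      (\<lambda>w. frechet_derivative g (at (prolong \<phi> (x, y))) (0, ?J ** w))) (at y)"
    by (rule has_derivative_compose) (rule compact_smooth_has_derivative[OF assms(4)])
  from has_derivative_unique[OF A this] show ?thesis by (simp add: p fun_eq_iff)
qed

lemma frame_Y_pullback:
  fixes g :: "'n::finite frame_fun"
  shows "frame_Y i j (frame_pullback \<phi> g) = frame_pullback \<phi> (frame_Y i j g)"
proof (transfer, rule ext)
  fix i j :: 'n and \<phi> :: "real^'n \<Rightarrow> real^'n" and g :: "'n frame \<Rightarrow> complex" and p
  assume "bij \<phi> \<and> smooth_on UNIV \<phi> \<and> smooth_on UNIV (inv \<phi>)" and g: "compact_smooth g"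
  then have \<phi>: "bij \<phi>" "smooth_on UNIV \<phi>" "smooth_on UNIV (inv \<phi>)" by simp_all
  show "vector_field_Y i j (\<lambda>p. g (prolong \<phi> p)) p = vector_field_Y i j g (prolong \<phi> p)"
    by (simp add: vector_field_Y_eq[OF compact_smooth_pullback[OF \<phi> g]] vector_field_Y_eq[OF g]
        frechet_derivative_pullback_vertical[OF \<phi> g])
      (simp add: matrix_mul_assoc prolong_def case_prod_beta)
qed

lemma frame_Y_mult:
  fixes f g :: "'n::finite frame_fun"
  shows "frame_Y i j (frame_mult f g) = frame_mult (frame_Y i j f) g + frame_mult f (frame_Y i j g)"
proof (transfer, rule ext)
  fix i j :: 'n and f g :: "'n frame \<Rightarrow> complex" and p
  assume *: "compact_smooth f" "compact_smooth g"
  have "compact_smooth (\<lambda>p. f p * g p)"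
    using * by (intro compact_smooth_bilinear[OF _ _ bounded_bilinear_mult]) (simp_all add: compact_smooth_def)
  moreover have "frechet_derivative (\<lambda>p. f p * g p) (at p) =
      (\<lambda>v. f p * frechet_derivative g (at p) v + frechet_derivative f (at p) v * g p)"
    by (rule frechet_derivativeI[OF has_derivative_mult[OF compact_smooth_has_derivative[OF *(1)]
          compact_smooth_has_derivative[OF *(2)]]])
  ultimately show "vector_field_Y i j (\<lambda>p. f p * g p) p =
      vector_field_Y i j f p * g p + f p * vector_field_Y i j g p"
    using * by (simp add: vector_field_Y_eq)
qed


section \<open>Affine equivariance\<close>

definition affine_diffeo :: "real^'n^'n \<Rightarrow> real^'n \<Rightarrow> 'n::finite diffeo" where
  "affine_diffeo M b = Diffeo (\<lambda>x. M *v x + b)"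

lemma smooth_affine: "smooth_on UNIV (\<lambda>x :: real^'n::finite. (M :: real^'n^'n) *v x + b)"
  unfolding smooth_on_def
  by (intro allI Ck_on_add Ck_on_linear Ck_on_const open_UNIV matrix_vector_mul_bounded_linear)

lemma diffeo_apply_affine:
  assumes "invertible M"
  shows "diffeo_apply (affine_diffeo M b) = (\<lambda>x. M *v x + b)"
proof -
  let ?f = "\<lambda>x. M *v x + b" and ?g = "\<lambda>x. matrix_inv M *v x + (- (matrix_inv M *v b))"
  have gf: "?g (?f x) = x" and fg: "?f (?g x) = x" for x
    using matrix_inv_props[OF assms]
    by (simp_all add: matrix_vector_right_distrib matrix_vector_mult_diff_distrib matrix_vector_mul_assoc
        del: add_uminus_conv_diff flip: diff_conv_add_uminus)
  have "bij ?f" by (rule o_bij[of ?g]) (simp_all only: o_def gf fg id_def)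
  moreover have "inv ?f = ?g" by (rule inv_equality[OF gf fg])
  ultimately show ?thesis
    unfolding affine_diffeo_def by (intro Diffeo_inverse) (simp add: smooth_affine del: add_uminus_conv_diff)
qed

lemma jacobian_affine: "jacobian (\<lambda>x :: real^'n::finite. (M :: real^'n^'n) *v x + b) (at x) = M"
proof -
  have "((\<lambda>x. M *v x + b) has_derivative (\<lambda>x. M *v x)) (at x)"
    by (rule has_derivative_eq_rhs, rule has_derivative_add[OF bounded_linear_imp_has_derivative has_derivative_const])
      (auto intro: matrix_vector_mul_bounded_linear)
  then show ?thesis by (simp add: jacobian_def frechet_derivativeI matrix_of_matrix_vector_mul)
qed

lemma prolong_affine: "prolong (\<lambda>x. M *v x + b) p = (M *v fst p + b, M ** snd p)"
  by (simp add: prolong_def case_prod_beta jacobian_affine)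

lemma frechet_derivative_pullback_affine:
  assumes "compact_smooth g"
  shows "frechet_derivative (\<lambda>p. g (prolong (\<lambda>x. M *v x + b) p)) (at p) (v, w) =
    frechet_derivative g (at (prolong (\<lambda>x. M *v x + b) p)) (M *v v, M ** w)"
proof -
  have "((\<lambda>p. (M *v fst p + b, M ** snd p)) has_derivative (\<lambda>v. (M *v fst v, M ** snd v))) (at p)"
  proof (intro has_derivative_Pair)
    have "((\<lambda>p. M *v fst p + b) has_derivative (\<lambda>v. M *v fst v + 0)) (at p)"
      by (intro has_derivative_add has_derivative_const bounded_linear_imp_has_derivative
          bounded_linear_compose[OF matrix_vector_mul_bounded_linear bounded_linear_fst])
    then show "((\<lambda>p. M *v fst p + b) has_derivative (\<lambda>v. M *v fst v)) (at p)" by simp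
  qed (intro bounded_linear_imp_has_derivative
      bounded_linear_compose[OF bounded_linear_matrix_mult_right bounded_linear_snd])
  from has_derivative_compose[OF this compact_smooth_has_derivative[OF assms]]
  show ?thesis by (simp add: prolong_affine frechet_derivativeI)
qed

lemma compact_smooth_pullback_affine:
  assumes "invertible M" "compact_smooth g"
  shows "compact_smooth (\<lambda>p. g (prolong (\<lambda>x. M *v x + b) p))"
  using compact_smooth_pullback[OF _ _ _ assms(2), of "diffeo_apply (affine_diffeo M b)"]
    diffeo_apply[of "affine_diffeo M b"]
  unfolding diffeo_apply_affine[OF assms(1)] by simp

lemma frame_X_affine:
  assumes "invertible M"
  shows "frame_X k (frame_pullback (affine_diffeo M b) g) = frame_pullback (affine_diffeo M b) (frame_X k g)"
proof (rule frame_eval_inject[THEN iffD1], rule ext)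
  fix p
  have g: "compact_smooth (frame_eval g)" using frame_eval by blast
  show "frame_eval (frame_X k (frame_pullback (affine_diffeo M b) g)) p =
      frame_eval (frame_pullback (affine_diffeo M b) (frame_X k g)) p"
    by (simp add: frame_X.rep_eq frame_pullback.rep_eq diffeo_apply_affine[OF assms] vector_field_X_eq[OF g]
        vector_field_X_eq[OF compact_smooth_pullback_affine[OF assms g]]
        frechet_derivative_pullback_affine[OF g])
      (simp add: prolong_affine column_matrix_mult linear_0[OF bounded_linear.linear[OF bounded_linear_matrix_mult_right]])
qed

lemma gamma_eq:
  assumes "bij \<phi>" "smooth_on UNIV \<phi>" "smooth_on UNIV (inv \<phi>)"
  shows "gamma i j k \<phi> p = (matrix_inv (snd p) ** matrix_inv (jacobian \<phi> (at (fst p))) **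
       frechet_derivative (\<lambda>z. jacobian \<phi> (at z)) (at (fst p)) (column k (snd p)) ** snd p) $ i $ j"
proof -
  have "Ck_on (Suc 0) UNIV (\<lambda>z. jacobian \<phi> (at z))"
    using assms(2) by (intro Ck_on_jacobian open_UNIV) (simp add: smooth_on_def del: Ck_on.simps)
  from Ck_on_has_derivative[OF this]
  have D: "bounded_linear (frechet_derivative (\<lambda>z. jacobian \<phi> (at z)) (at (fst p)))"
    using has_derivative_bounded_linear by blast
  define L where "L v = (matrix_inv (snd p) ** matrix_inv (jacobian \<phi> (at (fst p))) **
       frechet_derivative (\<lambda>z. jacobian \<phi> (at z)) (at (fst p)) v ** snd p) $ i $ j" for v
  have "bounded_linear L"
    unfolding L_def
    by (intro bounded_linear_compose[OF bounded_linear_vec_nth]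
        bounded_linear_compose[OF bounded_linear_matrix_mult_left]
        bounded_linear_compose[OF bounded_linear_matrix_mult_right] D)
  then interpret bounded_linear L .
  have "gamma i j k \<phi> p = (\<Sum>\<mu>\<in>UNIV. L (snd p $ \<mu> $ k *\<^sub>R axis \<mu> 1))"
    by (simp add: gamma_def case_prod_beta L_def[symmetric] scaleR mult.commute)
  also have "\<dots> = L (column k (snd p))"
    by (simp add: sum[symmetric] column_expansion)
  finally show ?thesis by (simp add: L_def)
qed

lemma matrix_inv_mult:
  fixes A B :: "real^'n^'n"
  assumes "invertible A" "invertible B"
  shows "matrix_inv (A ** B) = matrix_inv B ** matrix_inv A"
proof -
  have "(matrix_inv B ** matrix_inv A) ** (A ** B) = mat 1"
    using matrix_inv_props[OF assms(1)] matrix_inv_props[OF assms(2)]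
    by (metis matrix_mul_assoc matrix_mul_lid)
  then have "(matrix_inv B ** matrix_inv A) ** ((A ** B) ** matrix_inv (A ** B)) = matrix_inv (A ** B)"
    by (simp add: matrix_mul_assoc)
  then show ?thesis
    using matrix_inv_props(1)[OF invertible_mult[OF assms]] by simp
qed

text \<open>The function \<open>\<gamma>\<close> is a cocycle that vanishes on affine maps, because they have constant Jacobian.\<close>

lemma gamma_affine:
  fixes \<phi> :: "real^'n::finite \<Rightarrow> real^'n"
  assumes \<phi>: "bij \<phi>" "smooth_on UNIV \<phi>" "smooth_on UNIV (inv \<phi>)"
    and comp: "bij (\<phi> \<circ> (\<lambda>x. M *v x + b))" "smooth_on UNIV (\<phi> \<circ> (\<lambda>x. M *v x + b))"
      "smooth_on UNIV (inv (\<phi> \<circ> (\<lambda>x. M *v x + b)))"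
    and M: "invertible M" and p: "p \<in> frame_bundle"
  shows "gamma i j k (\<phi> \<circ> (\<lambda>x. M *v x + b)) p = gamma i j k \<phi> (prolong (\<lambda>x. M *v x + b) p)"
proof -
  let ?\<alpha> = "\<lambda>x. M *v x + b" and ?J = "\<lambda>z. jacobian \<phi> (at z)"
  have \<alpha>: "(?\<alpha> has_derivative (\<lambda>v. M *v v)) (at x)" for x
    by (rule has_derivative_eq_rhs, rule has_derivative_add[OF bounded_linear_imp_has_derivative has_derivative_const])
      (auto intro: matrix_vector_mul_bounded_linear)
  have "Ck_on 1 UNIV \<phi>" using \<phi>(2) by (simp add: smooth_on_def del: Ck_on.simps)
  then have "\<phi> differentiable (at x)" for x by simp
  then have J: "jacobian (\<phi> \<circ> ?\<alpha>) (at x) = ?J (?\<alpha> x) ** M" for x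
    using jacobian_chain[of ?\<alpha> x \<phi>] differentiableI[OF \<alpha>] by (simp add: o_def jacobian_affine)
  have "Ck_on (Suc 0) UNIV ?J"
    using \<phi>(2) by (intro Ck_on_jacobian open_UNIV) (simp add: smooth_on_def del: Ck_on.simps)
  note DJ = Ck_on_has_derivative[OF this UNIV_I]
  have DJM: "((\<lambda>x. ?J (?\<alpha> x) ** M) has_derivative (\<lambda>v. frechet_derivative ?J (at (?\<alpha> x)) (M *v v) ** M)) (at x)" for x
    by (rule bounded_linear.has_derivative[OF bounded_linear_matrix_mult_left has_derivative_compose[OF \<alpha> DJ]])
  then have D: "frechet_derivative (\<lambda>z. jacobian (\<phi> \<circ> ?\<alpha>) (at z)) (at x) v =
      frechet_derivative ?J (at (?\<alpha> x)) (M *v v) ** M" for x v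
    by (simp add: J frechet_derivativeI[OF DJM])
  have inv: "invertible (snd p)" "invertible (?J z)" for z
    using p invertible_jacobian_diffeo[OF \<phi>] by (auto simp: frame_bundle_def)
  show ?thesis
    unfolding gamma_eq[OF \<phi>] gamma_eq[OF comp] D
    by (simp add: J prolong_affine column_matrix_mult matrix_inv_mult inv M matrix_mul_assoc)
qed

lemma frame_eval_outside: "p \<notin> frame_bundle \<Longrightarrow> frame_eval g p = 0"
  using frame_eval[of g] unfolding compact_smooth_def by blast

text \<open>The identity for \<open>\<gamma>\<close> holds at invertible \<open>y\<close>. At singular \<open>y\<close> all functions on the frame bundle
  are zero, so the operators agree there too.\<close>

lemma frame_delta_affine:
  assumes "invertible M"
  shows "frame_delta i j k (diffeo_comp \<phi> (affine_diffeo M b)) (frame_pullback (affine_diffeo M b) g) =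
    frame_pullback (affine_diffeo M b) (frame_delta i j k \<phi> g)"
proof (rule frame_eval_inject[THEN iffD1], rule ext)
  fix p
  let ?\<alpha> = "affine_diffeo M b"
  show "frame_eval (frame_delta i j k (diffeo_comp \<phi> ?\<alpha>) (frame_pullback ?\<alpha> g)) p =
      frame_eval (frame_pullback ?\<alpha> (frame_delta i j k \<phi> g)) p"
  proof (cases "p \<in> frame_bundle")
    case True
    have "gamma i j k (diffeo_apply (diffeo_comp \<phi> ?\<alpha>)) p =
        gamma i j k (diffeo_apply \<phi>) (prolong (diffeo_apply ?\<alpha>) p)"
      using diffeo_apply[of \<phi>] diffeo_apply[of "diffeo_comp \<phi> ?\<alpha>"] assms True
      unfolding diffeo_comp.rep_eq diffeo_apply_affine[OF assms]
      by (intro gamma_affine) auto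
    then show ?thesis by (simp add: frame_delta.rep_eq frame_pullback.rep_eq)
  next
    case False
    then show ?thesis by (simp add: frame_eval_outside)
  qed
qed


section \<open>The crossed product\<close>

lemma poly_mapping_single_induct [case_names zero single add]:
  assumes "P 0" "\<And>k v. P (Poly_Mapping.single k v)" "\<And>x y. P x \<Longrightarrow> P y \<Longrightarrow> P (x + y)"
  shows "P (x :: 'k \<Rightarrow>\<^sub>0 'v::comm_monoid_add)"
proof -
  have "P (\<Sum>k\<in>S. Poly_Mapping.single k (Poly_Mapping.lookup x k))" for S
    by (induction S rule: infinite_finite_induct) (simp_all add: assms)
  moreover have "(\<Sum>k\<in>Poly_Mapping.keys x. Poly_Mapping.single k (Poly_Mapping.lookup x k)) = x"
    by (rule poly_mapping_eqI) (simp add: lookup_sum lookup_single when_def in_keys_iff)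
  ultimately show ?thesis by metis
qed

lemma frame_fun_eqI: "(\<And>p. frame_eval f p = frame_eval g p) \<Longrightarrow> f = g"
  by (simp add: frame_eval_inject[symmetric] fun_eq_iff)

lemma frame_mult_pullback_zero: "frame_mult 0 f = 0" "frame_mult f 0 = 0" "frame_pullback \<phi> 0 = 0"
  by (transfer; simp)+

lemma frame_mult_add: "frame_mult (f + f') g = frame_mult f g + frame_mult f' g"
    "frame_mult f (g + g') = frame_mult f g + frame_mult f g'"
  by (transfer; simp add: algebra_simps)+

lemma frame_mult_scaleC: "frame_mult (c *\<^sub>C f) g = c *\<^sub>C frame_mult f g"
    "frame_mult f (c *\<^sub>C g) = c *\<^sub>C frame_mult f g"
  by (transfer; simp add: algebra_simps)+

lemma frame_pullback_add: "frame_pullback \<phi> (f + g) = frame_pullback \<phi> f + frame_pullback \<phi> g"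
  and frame_pullback_scaleC: "frame_pullback \<phi> (c *\<^sub>C f) = c *\<^sub>C frame_pullback \<phi> f"
  by (transfer; simp)+

lemma crossed_mult_superset:
  assumes "finite S" "Poly_Mapping.keys a \<subseteq> S" "finite T" "Poly_Mapping.keys b \<subseteq> T"
  shows "crossed_mult a b = (\<Sum>\<phi>\<in>S. \<Sum>\<psi>\<in>T. Poly_Mapping.single (diffeo_comp \<psi> \<phi>)
     (frame_mult (Poly_Mapping.lookup a \<phi>) (frame_pullback \<phi> (Poly_Mapping.lookup b \<psi>))))"
proof -
  have "crossed_mult a b = (\<Sum>\<phi>\<in>Poly_Mapping.keys a. \<Sum>\<psi>\<in>T. Poly_Mapping.single (diffeo_comp \<psi> \<phi>)
     (frame_mult (Poly_Mapping.lookup a \<phi>) (frame_pullback \<phi> (Poly_Mapping.lookup b \<psi>))))"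
    unfolding crossed_mult_def using assms(3,4)
    by (intro sum.cong[OF refl] sum.mono_neutral_left) (auto simp: in_keys_iff frame_mult_pullback_zero)
  also have "\<dots> = (\<Sum>\<phi>\<in>S. \<Sum>\<psi>\<in>T. Poly_Mapping.single (diffeo_comp \<psi> \<phi>)
     (frame_mult (Poly_Mapping.lookup a \<phi>) (frame_pullback \<phi> (Poly_Mapping.lookup b \<psi>))))"
    using assms(1,2)
    by (intro sum.mono_neutral_left) (auto simp: in_keys_iff frame_mult_pullback_zero)
  finally show ?thesis .
qed

lemma crossed_mult_single:
  "crossed_mult (Poly_Mapping.single \<phi> g) (Poly_Mapping.single \<psi> h) =
    Poly_Mapping.single (diffeo_comp \<psi> \<phi>) (frame_mult g (frame_pullback \<phi> h))"
  by (subst crossed_mult_superset[of "{\<phi>}" _ "{\<psi>}"]) (simp_all add: lookup_single)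

lemma cbilinear_crossed_mult: "cbilinear crossed_mult"
proof (rule cbilinearI)
  fix a a' b b' :: "'a crossed" and c
  let ?k = Poly_Mapping.keys
  note sup = crossed_mult_superset[of "?k a \<union> ?k a'" _ "?k b \<union> ?k b'"]
  show "crossed_mult (a + a') b = crossed_mult a b + crossed_mult a' b"
    using keys_add[of a a']
    by (simp add: sup lookup_add frame_mult_add single_add sum.distrib le_supI1)
  show "crossed_mult a (b + b') = crossed_mult a b + crossed_mult a b'"
    using keys_add[of b b']
    by (simp add: sup lookup_add frame_mult_add frame_pullback_add single_add sum.distrib le_supI1)
  have "?k (c *\<^sub>C a) \<subseteq> ?k a" "?k (c *\<^sub>C b) \<subseteq> ?k b"
    by (auto simp: in_keys_iff lookup_scaleC)
  then show "crossed_mult (c *\<^sub>C a) b = c *\<^sub>C crossed_mult a b"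
    "crossed_mult a (c *\<^sub>C b) = c *\<^sub>C crossed_mult a b"
    by (simp_all add: crossed_mult_superset[of "?k a" _ "?k b"] lookup_scaleC frame_mult_scaleC
        frame_pullback_scaleC scaleC_single cvec.scale_sum_right)
qed

lemma crossed_mult_linear:
  "crossed_mult (a + a') b = crossed_mult a b + crossed_mult a' b"
  "crossed_mult a (b + b') = crossed_mult a b + crossed_mult a b'"
  "crossed_mult (c *\<^sub>C a) b = c *\<^sub>C crossed_mult a b"
  "crossed_mult a (c *\<^sub>C b) = c *\<^sub>C crossed_mult a b"
  "crossed_mult 0 b = 0" "crossed_mult a 0 = 0"
proof -
  have l: "clinear (\<lambda>a. crossed_mult a b)" and m: "clinear (crossed_mult a)" for a b :: "'a crossed"
    using cbilinear_crossed_mult by (auto simp: cbilinear_def)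
  show "crossed_mult (a + a') b = crossed_mult a b + crossed_mult a' b"
    "crossed_mult (c *\<^sub>C a) b = c *\<^sub>C crossed_mult a b" "crossed_mult 0 b = 0"
    by (rule clinear_add[OF l] clinear_scaleC[OF l] clinear_zero[OF l])+
  show "crossed_mult a (b + b') = crossed_mult a b + crossed_mult a b'"
    "crossed_mult a (c *\<^sub>C b) = c *\<^sub>C crossed_mult a b" "crossed_mult a 0 = 0"
    by (rule clinear_add[OF m] clinear_scaleC[OF m] clinear_zero[OF m])+
qed

lemma crossed_op_single:
  assumes "clinear (F \<phi>)"
  shows "crossed_op F (Poly_Mapping.single \<phi> g) = Poly_Mapping.single \<phi> (F \<phi> g)"
  by (cases "g = 0") (simp_all add: crossed_op_def clinear_zero[OF assms])

lemma clinear_op_Y: "clinear (op_Y i j)"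
  by (rule clinear_cm_ops[OF cm_Y])

lemma op_Y_single: "op_Y i j (Poly_Mapping.single \<phi> g) = Poly_Mapping.single \<phi> (frame_Y i j g)"
  unfolding op_Y_def by (rule crossed_op_single[OF clinear_frame_Y])

lemma op_Y_crossed_mult:
  "op_Y i j (crossed_mult a b) = crossed_mult (op_Y i j a) b + crossed_mult a (op_Y i j b)"
proof (induction a rule: poly_mapping_single_induct)
  case zero
  show ?case by (simp add: crossed_mult_linear clinear_zero[OF clinear_op_Y])
next
  case (single \<phi> g)
  show ?case
  proof (induction b rule: poly_mapping_single_induct)
    case zero
    show ?case by (simp add: crossed_mult_linear clinear_zero[OF clinear_op_Y])
  next
    case (single \<psi> h)
    show ?case
      by (simp add: op_Y_single crossed_mult_single frame_Y_mult frame_Y_pullback single_add)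
  next
    case (add x y)
    then show ?case by (simp add: crossed_mult_linear clinear_add[OF clinear_op_Y])
  qed
next
  case (add x y)
  then show ?case by (simp add: crossed_mult_linear clinear_add[OF clinear_op_Y])
qed


section \<open>Matrix coefficients of the Connes--Moscovici algebra\<close>

definition cm_coeff :: "'n diffeo \<Rightarrow> 'n frame_fun \<Rightarrow> 'n frame \<Rightarrow> 'n::finite cm_hopf \<Rightarrow> complex" where
  "cm_coeff \<phi> g p h = frame_eval (Poly_Mapping.lookup (cm_apply h (Poly_Mapping.single \<phi> g)) \<phi>) p"

lemma clinear_cm_coeff: "clinear (cm_coeff \<phi> g p)"
  by (rule clinearI) (simp_all add: cm_coeff_def plus_cm_hopf.rep_eq scaleC_cm_hopf.rep_eq lookup_add
      lookup_scaleC plus_frame_fun.rep_eq scaleC_frame_fun.rep_eq scaleC_complex_def)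

text \<open>All operators preserve the summands \<open>C\<^sub>c\<^sup>\<infinity> U\<^sup>*\<^bsub>\<phi>\<^esub>\<close> of the crossed product and commute with the
  translations \<open>g U\<^sup>*\<^bsub>\<phi>\<^esub> \<mapsto> (g \<circ> prolong \<alpha>) U\<^sup>*\<^bsub>\<phi> \<circ> \<alpha>\<^esub>\<close> by affine \<open>\<alpha>\<close>. The two claims share one witness
  so that they pass through compositions of operators together.\<close>

lemma cm_ops_single_affine:
  assumes M: "invertible M" and T: "T \<in> cm_ops"
  shows "\<exists>g'. T (Poly_Mapping.single \<phi> g) = Poly_Mapping.single \<phi> g' \<and>
    T (Poly_Mapping.single (diffeo_comp \<phi> (affine_diffeo M b)) (frame_pullback (affine_diffeo M b) g)) =
      Poly_Mapping.single (diffeo_comp \<phi> (affine_diffeo M b)) (frame_pullback (affine_diffeo M b) g')"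
  using T
proof (induction arbitrary: g rule: cm_ops.induct)
  case (cm_X k)
  show ?case
    unfolding op_X_def
    by (intro exI[of _ "frame_X k g"]) (simp add: crossed_op_single clinear_frame_X frame_X_affine[OF M])
next
  case (cm_Y i j)
  show ?case by (intro exI[of _ "frame_Y i j g"]) (simp add: op_Y_single frame_Y_pullback)
next
  case (cm_delta i j k)
  show ?case
    unfolding op_delta_def
    by (intro exI[of _ "frame_delta i j k \<phi> g"])
      (simp add: crossed_op_single clinear_frame_delta frame_delta_affine[OF M])
next
  case cm_one
  show ?case by blast
next
  case (cm_add S T)
  from cm_add.IH[of g] show ?case
    by (auto simp: frame_pullback_add simp flip: single_add)
next
  case (cm_scale S c)
  from cm_scale.IH[of g] show ?case
    by (auto simp: scaleC_single simp flip: frame_pullback_scaleC)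
next
  case (cm_mult S T)
  from cm_mult.IH(2)[of g] cm_mult.IH(1) show ?case by metis
qed

lemma invertible_mat_1: "invertible (mat 1 :: real^'n^'n)"
  by (auto simp: invertible_def intro: exI[of _ "mat 1"])

lemma cm_apply_single:
  "cm_apply h (Poly_Mapping.single \<phi> g) =
    Poly_Mapping.single \<phi> (Poly_Mapping.lookup (cm_apply h (Poly_Mapping.single \<phi> g)) \<phi>)"
  using cm_ops_single_affine[OF invertible_mat_1 cm_apply, of h \<phi> g 0] by (auto simp: lookup_single)

lemma cm_coeff_affine:
  assumes "invertible M"
  shows "cm_coeff (diffeo_comp \<phi> (affine_diffeo M b)) (frame_pullback (affine_diffeo M b) g) p h =
    cm_coeff \<phi> g (prolong (\<lambda>x. M *v x + b) p) h"
  using cm_ops_single_affine[OF assms cm_apply, of h \<phi> g b]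
  by (auto simp: cm_coeff_def frame_pullback.rep_eq diffeo_apply_affine[OF assms])

lemma cm_hopf_eq_0:
  assumes "\<And>\<phi> g p. cm_coeff \<phi> g p h = 0"
  shows "h = 0"
proof -
  have "cm_apply h a = 0" for a
  proof (induction a rule: poly_mapping_single_induct)
    case zero
    show ?case by (rule clinear_zero[OF clinear_cm_ops[OF cm_apply]])
  next
    case (single \<phi> g)
    have "Poly_Mapping.lookup (cm_apply h (Poly_Mapping.single \<phi> g)) \<phi> = 0"
      using assms by (intro frame_fun_eqI) (simp add: cm_coeff_def zero_frame_fun.rep_eq)
    then show ?case using cm_apply_single[of h \<phi> g] by simp
  next
    case (add x y)
    then show ?case by (simp add: clinear_add[OF clinear_cm_ops[OF cm_apply]])
  qed
  moreover have "cm_apply 0 a = (0 :: 'a crossed)" for a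
    unfolding zero_cm_hopf_def scaleC_cm_hopf.rep_eq by simp
  ultimately show ?thesis by (simp add: cm_apply_inject[symmetric] fun_eq_iff)
qed

lemma prolong_affine_transitive:
  assumes "p \<in> frame_bundle" "q \<in> frame_bundle"
  obtains M b where "invertible M" "prolong (\<lambda>x. M *v x + b) p = q"
proof -
  let ?M = "snd q ** matrix_inv (snd p)"
  have inv: "invertible (snd p)" "invertible (snd q)" using assms by (auto simp: frame_bundle_def)
  have "?M ** snd p = snd q"
    using matrix_inv_props(2)[OF inv(1)] by (metis matrix_mul_assoc matrix_mul_rid)
  moreover have "invertible ?M"
    using inv matrix_inv_props[OF inv(1)] by (intro invertible_mult) (auto simp: invertible_def)
  ultimately show ?thesis
    using that[of ?M "fst q - ?M *v fst p"] by (simp add: prolong_affine)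
qed

text \<open>By affine equivariance, the value of \<open>h\<close> at a point \<open>q\<close> is the value at \<open>p\<close> of \<open>h\<close> on a
  translated argument. Affine maps act transitively on the frame bundle, so the values at a single
  point determine \<open>h\<close>.\<close>

lemma cm_hopf_eq_0_at_point:
  assumes p: "p \<in> frame_bundle" and "\<And>\<phi> g. cm_coeff \<phi> g p h = 0"
  shows "h = 0"
proof (rule cm_hopf_eq_0)
  fix \<phi> g q
  show "cm_coeff \<phi> g q h = 0"
  proof (cases "q \<in> frame_bundle")
    case True
    obtain M b where "invertible M" "prolong (\<lambda>x. M *v x + b) p = q"
      using prolong_affine_transitive[OF p True] .
    then show ?thesis using assms(2) cm_coeff_affine by metis
  next
    case False
    then show ?thesis by (simp add: cm_coeff_def frame_eval_outside)
  qed
qed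


section \<open>The coproduct\<close>

lemma cbilinear_cm_apply:
  "cbilinear (\<lambda>h1 h2. crossed_mult (cm_apply h1 a) (cm_apply h2 b))"
  by (rule cbilinearI) (simp_all add: plus_cm_hopf.rep_eq scaleC_cm_hopf.rep_eq crossed_mult_linear)

text \<open>In a product \<open>g U\<^sup>*\<^bsub>\<phi>\<^esub> k U\<^sup>*\<^bsub>\<psi>\<^esub>\<close> the first factor is evaluated at \<open>p\<close> and the second at the
  prolongation of \<open>p\<close>; this is where a second point of the frame bundle enters.\<close>

lemma cm_coeff_slice:
  "cm_coeff \<psi> k (prolong (diffeo_apply \<phi>) p) (slice_left (cm_coeff \<phi> g p) t) =
    frame_eval (Poly_Mapping.lookup (tensor_lift (\<lambda>h1 h2. crossed_mult (cm_apply h1 (Poly_Mapping.single \<phi> g))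
      (cm_apply h2 (Poly_Mapping.single \<psi> k))) t) (diffeo_comp \<psi> \<phi>)) p"
    (is "_ = frame_eval (Poly_Mapping.lookup (tensor_lift ?m t) _) p")
proof (induction t rule: tensor_induct)
  case zero
  show ?case
    by (simp add: clinear_zero[OF clinear_tensor_lift[OF cbilinear_cm_apply]]
        clinear_zero[OF clinear_slice(1)[OF clinear_cm_coeff]] clinear_zero[OF clinear_cm_coeff] zero_frame_fun.rep_eq)
next
  case (tensor h1 h2)
  have "?m h1 h2 = Poly_Mapping.single (diffeo_comp \<psi> \<phi>)
      (frame_mult (Poly_Mapping.lookup (cm_apply h1 (Poly_Mapping.single \<phi> g)) \<phi>)
        (frame_pullback \<phi> (Poly_Mapping.lookup (cm_apply h2 (Poly_Mapping.single \<psi> k)) \<psi>)))"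
    using cm_apply_single[of h1 \<phi> g] cm_apply_single[of h2 \<psi> k] crossed_mult_single by metis
  then show ?case
    by (simp add: tensor_lift_tensor[OF cbilinear_cm_apply] slice_tensor(1)[OF clinear_cm_coeff]
        clinear_scaleC[OF clinear_cm_coeff] scaleC_complex_def lookup_single frame_mult.rep_eq
        frame_pullback.rep_eq)
      (simp add: cm_coeff_def)
next
  case (add x y)
  then show ?case
    by (simp add: clinear_add[OF clinear_tensor_lift[OF cbilinear_cm_apply]]
        clinear_add[OF clinear_slice(1)[OF clinear_cm_coeff]] clinear_add[OF clinear_cm_coeff]
        lookup_add plus_frame_fun.rep_eq)
qed

text \<open>Fix the first argument \<open>g U\<^sup>*\<^bsub>\<phi>\<^esub>\<close> and the point \<open>p\<close>. The left slice of \<open>t\<close> by the corresponding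
  matrix coefficient is an element of the algebra whose values at the single point
  \<open>prolong \<phi> p\<close> all vanish, hence it is \<open>0\<close>. Matrix coefficients separate the elements of the algebra,
  so \<open>t = 0\<close>.\<close>

lemma cm_tensor_action_faithful:
  fixes t :: "('n::finite cm_hopf, 'n cm_hopf) tensor"
  assumes "\<And>a b. tensor_lift (\<lambda>h1 h2. crossed_mult (cm_apply h1 a) (cm_apply h2 b)) t = 0"
  shows "t = 0"
proof (rule tensor_eq_0_if_separating_slices)
  let ?\<Phi> = "{cm_coeff \<phi> g p | \<phi> g p. p \<in> (frame_bundle :: 'n frame set)}"
  show "clinear \<nu>" if "\<nu> \<in> ?\<Phi>" for \<nu>
    using that clinear_cm_coeff by blast
  show "h = 0" if "\<And>\<nu>. \<nu> \<in> ?\<Phi> \<Longrightarrow> \<nu> h = 0" for h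
  proof (rule cm_hopf_eq_0)
    fix \<phi> g p
    show "cm_coeff \<phi> g p h = 0"
    proof (cases "p \<in> frame_bundle")
      case True
      then show ?thesis using that by blast
    next
      case False
      then show ?thesis by (simp add: cm_coeff_def frame_eval_outside)
    qed
  qed
  show "slice_left \<nu> t = 0" if "\<nu> \<in> ?\<Phi>" for \<nu>
  proof -
    obtain \<phi> g p where \<nu>: "\<nu> = cm_coeff \<phi> g p" and p: "p \<in> frame_bundle"
      using \<open>\<nu> \<in> ?\<Phi>\<close> by blast
    have "prolong (diffeo_apply \<phi>) p \<in> frame_bundle"
      using p diffeo_apply[of \<phi>] by (simp add: prolong_frame_bundle)
    then show ?thesis
      unfolding \<nu> by (rule cm_hopf_eq_0_at_point) (simp add: cm_coeff_slice assms zero_frame_fun.rep_eq)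
  qed
qed

text \<open>Faithfulness of the action of the tensor square makes the defining property of the coproduct
  characterise it uniquely.\<close>

lemma cm_coproduct_eqI:
  assumes "\<And>a b. cm_apply h (crossed_mult a b) =
     tensor_lift (\<lambda>h1 h2. crossed_mult (cm_apply h1 a) (cm_apply h2 b)) t"
  shows "cm_coproduct h = t"
  unfolding cm_coproduct_def
proof (rule the_equality)
  fix t' assume t': "\<forall>a b. cm_apply h (crossed_mult a b) =
     tensor_lift (\<lambda>h1 h2. crossed_mult (cm_apply h1 a) (cm_apply h2 b)) t'"
  have "t' - t = 0"
    by (rule cm_tensor_action_faithful)
      (simp add: clinear_diff[OF clinear_tensor_lift[OF cbilinear_cm_apply]] t'[rule_format, symmetric]
        assms[symmetric])
  then show "t' = t" by simp
qed (simp add: assms)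

definition cm_Y_gen :: "'n \<Rightarrow> 'n \<Rightarrow> 'n::finite cm_hopf" where
  "cm_Y_gen i j = Cm_Hopf (op_Y i j)"

lemma cm_apply_Y: "cm_apply (cm_Y_gen i j) = op_Y i j"
  unfolding cm_Y_gen_def by (rule Cm_Hopf_inverse[OF cm_Y])

lemma cm_coproduct_Y: "cm_coproduct (cm_Y_gen i j) = cm_Y_gen i j \<otimes> 1 + 1 \<otimes> cm_Y_gen i j"
  by (rule cm_coproduct_eqI)
    (simp add: clinear_add[OF clinear_tensor_lift[OF cbilinear_cm_apply]]
      tensor_lift_tensor[OF cbilinear_cm_apply] cm_apply_Y one_cm_hopf.rep_eq op_Y_crossed_mult)


section \<open>The generators \<open>Y\<^sub>i\<^sup>i\<close> are not algebraic\<close>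

lemma cm_apply_power: "cm_apply (h ^ n) a = (cm_apply h ^^ n) a"
  by (induction n) (simp_all add: one_cm_hopf.rep_eq times_cm_hopf.rep_eq)

lemma op_Y_funpow_single:
  "(op_Y i j ^^ n) (Poly_Mapping.single \<phi> g) = Poly_Mapping.single \<phi> ((frame_Y i j ^^ n) g)"
  by (induction n) (simp_all add: op_Y_single)

lemma Ck_on_power:
  fixes f :: "'a::real_normed_vector \<Rightarrow> complex"
  assumes "open S" "Ck_on k S f"
  shows "Ck_on k S (\<lambda>x. f x ^ m)"
  by (induction m) (simp_all add: Ck_on_const Ck_on_bilinear[OF _ bounded_bilinear_mult] assms del: Ck_on.simps)

text \<open>Each application of \<open>Y\<^sub>i\<^sup>i\<close> lowers the order of vanishing along \<open>u = 0\<close>, where \<open>u\<close> is the coordinate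
  \<open>y\<^sup>i\<^sub>i - 1\<close>, by at most one; it lowers it by exactly one where \<open>u = 0\<close> and \<open>c\<close> does not vanish,
  because \<open>Y\<^sub>i\<^sup>i u = y\<^sup>i\<^sub>i = 1\<close> there.\<close>

lemma vector_field_Y_vanishing_order:
  fixes c :: "'n::finite frame \<Rightarrow> complex" and i :: 'n
  defines "u \<equiv> (\<lambda>p :: 'n frame. of_real (snd p $ i $ i) - 1 :: complex)"
  assumes c: "compact_smooth c"
  shows "vector_field_Y i i (\<lambda>p. c p * u p ^ Suc m) p =
    (vector_field_Y i i c p * u p + of_nat (Suc m) * of_real (snd p $ i $ i) * c p) * u p ^ m"
    and "compact_smooth (\<lambda>p. c p * u p ^ m)"
proof -
  have u: "Ck_on k frame_bundle u" for k
  proof -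
    have "Ck_on k frame_bundle (\<lambda>p :: 'n frame. of_real (snd p $ i $ i) + (- 1 :: complex))"
      by (intro Ck_on_add Ck_on_linear_compose[OF _ bounded_linear_of_real] Ck_on_nth Ck_on_linear
          Ck_on_const open_frame_bundle bounded_linear_snd)
    then show ?thesis by (simp add: u_def)
  qed
  show cs: "compact_smooth (\<lambda>p. c p * u p ^ m)" for m
    using compact_smooth_bilinear[OF _ c bounded_bilinear_mult, of "\<lambda>p. u p ^ m"] Ck_on_power[OF open_frame_bundle u]
    by (simp add: smooth_on_def mult.commute)
  have d: "(u has_derivative (\<lambda>v. of_real (snd v $ i $ i))) (at p)"
    unfolding u_def by (auto intro!: derivative_eq_intros bounded_linear_imp_has_derivative
        bounded_linear_compose[OF bounded_linear_of_real] bounded_linear_compose[OF bounded_linear_vec_nth]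
        bounded_linear_snd)
  have "((\<lambda>p. c p * u p ^ Suc m) has_derivative (\<lambda>v. c p * (of_nat (Suc m) * u p ^ m * of_real (snd v $ i $ i))
      + frechet_derivative c (at p) v * u p ^ Suc m)) (at p)"
    by (rule has_derivative_eq_rhs[OF has_derivative_mult[OF compact_smooth_has_derivative[OF c]
          has_derivative_power[OF d]]]) (simp add: fun_eq_iff algebra_simps)
  note D = frechet_derivativeI[OF this]
  have "(snd p ** axis i (axis i 1)) $ i $ i = snd p $ i $ i"
    by (simp add: matrix_matrix_mult_def axis_def if_distrib[of "(*) _"] if_distrib[of "\<lambda>x. x $ _"] cong: if_cong)
  then show "vector_field_Y i i (\<lambda>p. c p * u p ^ Suc m) p =
    (vector_field_Y i i c p * u p + of_nat (Suc m) * of_real (snd p $ i $ i) * c p) * u p ^ m"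
    unfolding vector_field_Y_eq[OF cs] vector_field_Y_eq[OF c] D
    by (simp add: algebra_simps)
qed

lemma frame_Y_funpow_rep: "frame_eval ((frame_Y i j ^^ k) g) = (vector_field_Y i j ^^ k) (frame_eval g)"
  by (induction k) (simp_all add: frame_Y.rep_eq)

lemma vector_field_Y_power_vanishing:
  fixes c :: "'n::finite frame \<Rightarrow> complex" and i :: 'n and N :: nat
  defines "u \<equiv> (\<lambda>p :: 'n frame. of_real (snd p $ i $ i) - 1 :: complex)"
  assumes c: "compact_smooth c" and "k \<le> N"
  shows "\<exists>c'. compact_smooth c' \<and>
    (vector_field_Y i i ^^ k) (\<lambda>p. c p * u p ^ N) = (\<lambda>p. c' p * u p ^ (N - k)) \<and>
    (\<forall>p. u p = 0 \<longrightarrow> c p \<noteq> 0 \<longrightarrow> c' p \<noteq> 0)"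
  using \<open>k \<le> N\<close>
proof (induction k)
  case 0
  show ?case using c by auto
next
  case (Suc k)
  then obtain c' where c': "compact_smooth c'"
    "(vector_field_Y i i ^^ k) (\<lambda>p. c p * u p ^ N) = (\<lambda>p. c' p * u p ^ (N - k))"
    "\<forall>p. u p = 0 \<longrightarrow> c p \<noteq> 0 \<longrightarrow> c' p \<noteq> 0"
    by auto
  obtain m where m: "N - k = Suc m" using Suc.prems by (metis Suc_diff_Suc Suc_le_lessD)
  let ?d = "\<lambda>p. vector_field_Y i i c' p * u p + of_nat (Suc m) * of_real (snd p $ i $ i) * c' p"
  have "vector_field_Y i i (\<lambda>p. c' p * u p ^ Suc m) = (\<lambda>p. ?d p * u p ^ m)"
    unfolding u_def by (rule ext) (rule vector_field_Y_vanishing_order(1)[OF c'(1)])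
  then have funpow: "(vector_field_Y i i ^^ Suc k) (\<lambda>p. c p * u p ^ N) = (\<lambda>p. ?d p * u p ^ m)"
    by (simp only: funpow.simps o_apply c'(2) m)
  have smooth: "compact_smooth ?d"
  proof -
    have "compact_smooth (\<lambda>p. vector_field_Y i i c' p * u p ^ 1)"
      unfolding u_def by (rule vector_field_Y_vanishing_order(2)[OF compact_smooth_Y[OF c'(1)]])
    moreover have "compact_smooth (\<lambda>p. of_nat (Suc m) * ((snd p $ i $ i) *\<^sub>R c' p))"
      by (intro compact_smooth_scaleC compact_smooth_scaleR smooth_frame_coord c'(1))
    ultimately show ?thesis
      using compact_smooth_add by (fastforce simp: scaleR_conv_of_real mult.assoc)
  qed
  have nonzero: "?d p \<noteq> 0" if "u p = 0" "c p \<noteq> 0" for p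
  proof -
    have "complex_of_real (snd p $ i $ i) = 1" using that(1) by (simp add: u_def)
    moreover have "c' p \<noteq> 0" using that c'(3) by blast
    ultimately show ?thesis using that(1) by (simp del: of_nat_Suc)
  qed
  have "N - Suc k = m" using m by simp
  then show ?case
    using smooth funpow nonzero by (intro exI[of _ ?d] conjI allI impI) simp_all
qed

text \<open>The functional is \<open>h \<mapsto> h (c u\<^sup>N U\<^sup>*\<^bsub>id\<^esub>)\<close>, evaluated at the point \<open>e = (0, 1)\<close>, with a bump function
  \<open>c\<close> at \<open>e\<close>. The function \<open>c u\<^sup>N\<close> vanishes at \<open>e\<close> to order \<open>N\<close>, so exactly \<open>N\<close> applications of
  \<open>Y\<^sub>i\<^sup>i\<close> are needed for a nonzero value at \<open>e\<close>.\<close>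

lemma cm_Y_not_algebraic:
  fixes i :: "'n::finite"
  shows "\<exists>\<mu>. clinear \<mu> \<and> (\<forall>k<N. \<mu> (cm_Y_gen i i ^ k) = 0) \<and> \<mu> (cm_Y_gen i i ^ N) \<noteq> (0 :: complex)"
proof -
  define u :: "'n frame \<Rightarrow> complex" where "u = (\<lambda>p. of_real (snd p $ i $ i) - 1)"
  define e :: "'n frame" where "e = (0, mat 1)"
  have e: "e \<in> frame_bundle" "u e = 0"
    using invertible_mat_1 by (simp_all add: e_def u_def frame_bundle_def) (simp add: mat_def)
  obtain b :: "'n frame \<Rightarrow> real" and K where b: "smooth_on frame_bundle b" "compact K" "K \<subseteq> frame_bundle"
    "\<And>q. q \<notin> K \<Longrightarrow> b q = 0" "b e \<noteq> 0"
    by (rule exists_bump[OF open_frame_bundle e(1)]) (rule that)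
  define c where "c q = complex_of_real (b q)" for q
  have c: "compact_smooth c"
    using b(1-4) unfolding compact_smooth_def smooth_on_def c_def
    by (auto intro!: Ck_on_linear_compose[OF open_frame_bundle bounded_linear_of_real])
  define g where "g = Frame_Fun (\<lambda>p. c p * u p ^ N)"
  have g: "frame_eval g = (\<lambda>p. c p * u p ^ N)"
    unfolding g_def u_def
    by (rule Frame_Fun_inverse) (simp add: vector_field_Y_vanishing_order(2)[OF c])
  have coeff: "cm_coeff diffeo_id g e (cm_Y_gen i i ^ k) = (vector_field_Y i i ^^ k) (\<lambda>p. c p * u p ^ N) e" for k
    by (simp add: cm_coeff_def cm_apply_power cm_apply_Y op_Y_funpow_single lookup_single frame_Y_funpow_rep g)
  have order: "\<exists>c'. c' \<noteq> 0 \<and> cm_coeff diffeo_id g e (cm_Y_gen i i ^ k) = c' * 0 ^ (N - k)"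
    if kN: "k \<le> N" for k
  proof -
    obtain c' where c': "(vector_field_Y i i ^^ k) (\<lambda>p. c p * u p ^ N) = (\<lambda>p. c' p * u p ^ (N - k))"
      "\<forall>p. u p = 0 \<longrightarrow> c p \<noteq> 0 \<longrightarrow> c' p \<noteq> 0"
      using vector_field_Y_power_vanishing[OF c kN, of i] unfolding u_def by blast
    have "c e \<noteq> 0" using b(5) by (simp add: c_def)
    then have "c' e \<noteq> 0" using c'(2) e(2) by blast
    then show ?thesis unfolding coeff c'(1) e(2) by blast
  qed
  then have "cm_coeff diffeo_id g e (cm_Y_gen i i ^ k) = 0" if "k < N" for k
    using that by (metis less_imp_le mult_zero_right power_0_left zero_less_diff less_irrefl)
  moreover have "cm_coeff diffeo_id g e (cm_Y_gen i i ^ N) \<noteq> 0"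
    using order[of N] by auto
  ultimately show ?thesis using clinear_cm_coeff by blast
qed

theorem proposition4p1:
  fixes \<rho> :: "'a::complex_algebra_1 \<Rightarrow> ('a, 'n::finite cm_hopf) tensor"
  assumes "finite_dimensional TYPE('a)"
    and "right_comodule_algebra cm_coproduct cm_counit \<rho>"
    and "\<not> trivial_coaction \<rho>"
  shows "\<not> (\<exists>f. total_integral cm_coproduct \<rho> f \<and> algebra_map f)"
proof
  assume "\<exists>f. total_integral cm_coproduct \<rho> f \<and> algebra_map f"
  then obtain f where f: "total_integral cm_coproduct \<rho> f" by blast
  have \<rho>: "algebra_map \<rho>" using assms(2) by (simp add: right_comodule_algebra_def)
  have "(1 :: 'a) = 0"
    by (rule total_integral_primitive_zero_algebra[OF assms(1) \<rho> f cm_coproduct_Y cm_Y_not_algebraic])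
  then have "a = 0" for a :: 'a
    by (metis mult_1_left mult_zero_left)
  then have "trivial_coaction \<rho>"
    using clinear_zero[of \<rho>] \<rho> unfolding trivial_coaction_def algebra_map_def by (metis tensor_zero_left)
  then show False using assms(3) by blast
qed

end
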